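(* There exist sequences of groups $(B(m))_m$, indexed by positive integers $m$, such that each $B(m)$ is finitely presented, centerless and residually free, the product rank of $B(m)$ is exactly $m$, and $d(B(m))=O(\log m)$ as $m\to\infty$.
   Context: $d(G)$ denotes the minimal cardinality of a generating set of $G$. A group $G$ is residually free if for every $g\in G\smallsetminus\{1\}$ there is a homomorphism $\phi$ from $G$ to a free group with $\phi(g)\ne1$. Centerless means having trivial centre. The product rank of $G$ is the largest integer $n$ such that $G$ contains a subgroup isomorphic to the direct product of $n$ copies of the free group $F_2$ of rank $2$. *)

theory Defs
  imports "HOL-Algebra.Product_Groups" "HOL-Library.Landau_Symbols"
begin

(* The letter (True, x) stands for the generator x, and (False, x) for its formal inverse. *)

type_synonym 'a letter = "bool \<times> 'a"

definition inv_letter :: "'a letter \<Rightarrow> 'a letter" where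
  "inv_letter l = (\<not> fst l, snd l)"

definition reduced_words :: "'a set \<Rightarrow> 'a letter list set" where
  "reduced_words S =
     {w \<in> lists (UNIV \<times> S). successively (\<lambda>l l'. l' \<noteq> inv_letter l) w}"

fun push_letter :: "'a letter \<Rightarrow> 'a letter list \<Rightarrow> 'a letter list" where
  "push_letter l [] = [l]"
| "push_letter l (l' # w) = (if l' = inv_letter l then w else l # l' # w)"

(* The free group with basis S; the product of two reduced words is the free reduction
   of their concatenation. *)

definition free_group :: "'a set \<Rightarrow> 'a letter list monoid" where
  "free_group S =
     \<lparr>carrier = reduced_words S, mult = (\<lambda>u v. foldr push_letter u v), one = []\<rparr>"

definition normal_closure :: "('a, 'b) monoid_scheme \<Rightarrow> 'a set \<Rightarrow> 'a set" where
  "normal_closure G R = \<Inter> {N. N \<lhd> G \<and> R \<subseteq> N}"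

definition finitely_presented :: "('a, 'b) monoid_scheme \<Rightarrow> bool" where
  "finitely_presented G \<longleftrightarrow>
     (\<exists>(S :: nat set) R. finite S \<and> finite R \<and> R \<subseteq> carrier (free_group S) \<and>
        G \<cong> free_group S Mod normal_closure (free_group S) R)"

definition center :: "('a, 'b) monoid_scheme \<Rightarrow> 'a set" where
  "center G = {z \<in> carrier G. \<forall>g \<in> carrier G. z \<otimes>\<^bsub>G\<^esub> g = g \<otimes>\<^bsub>G\<^esub> z}"

definition centerless :: "('a, 'b) monoid_scheme \<Rightarrow> bool" where
  "centerless G \<longleftrightarrow> center G = {\<one>\<^bsub>G\<^esub>}"

(* Free groups with bases in nat suffice: a nontrivial element of any free group involves only
   finitely many basis elements and survives the retraction that kills all the others. *)

definition residually_free :: "('a, 'b) monoid_scheme \<Rightarrow> bool" where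
  "residually_free G \<longleftrightarrow>
     (\<forall>g \<in> carrier G - {\<one>\<^bsub>G\<^esub>}. \<exists>(S :: nat set). \<exists>\<phi> \<in> hom G (free_group S).
        \<phi> g \<noteq> \<one>\<^bsub>free_group S\<^esub>)"

definition contains_F2_power :: "('a, 'b) monoid_scheme \<Rightarrow> nat \<Rightarrow> bool" where
  "contains_F2_power G n \<longleftrightarrow>
     (\<exists>H. subgroup H G \<and>
        G\<lparr>carrier := H\<rparr> \<cong> product_group {..<n} (\<lambda>_. free_group {..<2::nat}))"

(* A relation rather than a function, since a largest n need not exist. *)

definition has_product_rank :: "('a, 'b) monoid_scheme \<Rightarrow> nat \<Rightarrow> bool" where
  "has_product_rank G n \<longleftrightarrow>
     contains_F2_power G n \<and> (\<forall>k. contains_F2_power G k \<longrightarrow> k \<le> n)"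

(* The invariant d(G); meaningful only for finitely generated G. *)

definition min_generators :: "('a, 'b) monoid_scheme \<Rightarrow> nat" where
  "min_generators G =
     (LEAST n. \<exists>S. S \<subseteq> carrier G \<and> finite S \<and> card S = n \<and> generate G S = carrier G)"

end

theory Submission
  imports Defs "HOL-Library.Set_Algebras" "HOL-Library.Countable"
begin

text \<open>
  Let \<open>\<Phi>\<close> be free on \<open>4 * k\<close> generators and \<open>L i\<close>, for \<open>i < 2 ^ k\<close>, the kernel of the map to \<open>F2\<close>
  that reads off the binary digits of \<open>i\<close>; any two coordinates differ in a digit, so
  \<open>L i + L j = \<Phi>\<close>.  The group is \<open>B m = \<Phi> / E m\<close> with \<open>E n\<close> the intersection of the \<open>L i\<close>, \<open>i < n\<close>:
  a subgroup of \<open>F2 ^ m\<close> projecting onto every pair of factors, with \<open>m\<close> at most \<open>2 ^ k\<close>.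

  Finite presentability means that \<open>E n\<close> is the normal closure of a finite set, shown by induction
  on \<open>n\<close>.  Write \<open>E = E n\<close> and \<open>L = L n\<close>.  Since \<open>L\<close> is finitely generated modulo \<open>E\<close>, finitely
  many elements of \<open>E \<inter> L\<close> normally generate a subgroup \<open>D\<close> containing \<open>[E, L]\<close>.  As \<open>\<Phi> / L\<close> is free,
  \<open>E \<rightarrow> E / (E \<inter> L)\<close> splits, hence \<open>[E, E] \<inter> L \<subseteq> D\<close>.  So \<open>(E \<inter> L) / D\<close> embeds into \<open>E / [E, E] D\<close>, a
  finitely generated module over the group ring of \<open>\<Phi> / E L\<close>.  That group is an iterated central
  extension by finitely generated abelian groups, because \<open>[E i, \<Phi>] = [E i, L i + L n] \<subseteq> E (i + 1) + L n\<close>;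
  so its group ring is noetherian by P. Hall's argument, and \<open>(E \<inter> L) / D\<close> is finitely generated too.

  The product rank is at most \<open>m\<close> by commutative transitivity of free groups, and at least \<open>m\<close>
  because iterated commutators produce free subgroups supported in a single coordinate.
\<close>

section \<open>Subgroups and conjugation\<close>

lemmas group_norm = add.assoc minus_add diff_conv_add_uminus

definition cj :: "'g::group_add \<Rightarrow> 'g \<Rightarrow> 'g" where
  "cj g u = g + u - g"

definition comm :: "'g::group_add \<Rightarrow> 'g \<Rightarrow> 'g" where
  "comm x y = x + y - x - y"

lemma cj_add: "cj g (u + v) = cj g u + cj g v"
  and cj_minus: "cj g (- u) = - cj g u"
  and cj_diff: "cj g (u - v) = cj g u - cj g v"
  and cj_zero [simp]: "cj g 0 = 0"
  and cj_zero_left [simp]: "cj 0 u = u"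
  and cj_cj: "cj (g + h) u = cj g (cj h u)"
  and cj_inv [simp]: "cj (- g) (cj g u) = u"
  and cj_inv' [simp]: "cj g (cj (- g) u) = u"
  by (simp_all add: cj_def group_norm del: add_uminus_conv_diff)

lemma cj_cj_diff: "cj (g - h) u = cj g (cj (- h) u)"
  using cj_cj[of g "- h"] by simp

lemma cj_cj_left: "cj (cj g h) (cj g u) = cj g (cj h u)"
  by (simp add: cj_def group_norm del: add_uminus_conv_diff)

lemma cj_eq_comm: "cj g u = comm g u + u"
  by (simp add: cj_def comm_def group_norm del: add_uminus_conv_diff)

lemma comm_minus: "- comm x y = comm y x"
  by (simp add: comm_def group_norm del: add_uminus_conv_diff)

definition add_subgroup :: "'g::group_add set \<Rightarrow> bool" where
  "add_subgroup H \<longleftrightarrow> 0 \<in> H \<and> (\<forall>x\<in>H. \<forall>y\<in>H. x + y \<in> H) \<and> (\<forall>x\<in>H. - x \<in> H)"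

definition conj_closed :: "'g::group_add set \<Rightarrow> 'g set \<Rightarrow> bool" where
  "conj_closed P U \<longleftrightarrow> (\<forall>g\<in>P. \<forall>u\<in>U. cj g u \<in> U)"

lemma add_subgroupI:
  assumes "0 \<in> H" "\<And>x y. x \<in> H \<Longrightarrow> y \<in> H \<Longrightarrow> x + y \<in> H" "\<And>x. x \<in> H \<Longrightarrow> - x \<in> H"
  shows "add_subgroup H"
  using assms by (auto simp: add_subgroup_def)

lemma add_subgroupD:
  assumes "add_subgroup H"
  shows "0 \<in> H" "x \<in> H \<Longrightarrow> y \<in> H \<Longrightarrow> x + y \<in> H" "x \<in> H \<Longrightarrow> - x \<in> H"
    "x \<in> H \<Longrightarrow> y \<in> H \<Longrightarrow> x - y \<in> H"
  using assms unfolding add_subgroup_def diff_conv_add_uminus by blast+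

lemma add_subgroup_cancel:
  assumes "add_subgroup H" "x \<in> H"
  shows "x + y \<in> H \<longleftrightarrow> y \<in> H" "y + x \<in> H \<longleftrightarrow> y \<in> H" "y - x \<in> H \<longleftrightarrow> y \<in> H"
    "x - y \<in> H \<longleftrightarrow> y \<in> H"
proof -
  show a: "x + y \<in> H \<longleftrightarrow> y \<in> H" for y
    using add_subgroupD(2)[OF assms(1), of "- x" "x + y"] add_subgroupD[OF assms(1)] assms(2) by auto
  show b: "y + x \<in> H \<longleftrightarrow> y \<in> H" for y
    using add_subgroupD(4)[OF assms(1), of "y + x" x] add_subgroupD[OF assms(1)] assms(2) by auto
  show "y - x \<in> H \<longleftrightarrow> y \<in> H"
    using b[of "y - x"] by simp
  show "x - y \<in> H \<longleftrightarrow> y \<in> H"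
    using a[of "- y"] add_subgroupD(3)[OF assms(1)] by (metis diff_conv_add_uminus minus_minus)
qed

lemma conj_closedD: "conj_closed P U \<Longrightarrow> g \<in> P \<Longrightarrow> u \<in> U \<Longrightarrow> cj g u \<in> U"
  by (simp add: conj_closed_def)

lemma conj_closedI: "(\<And>g u. g \<in> P \<Longrightarrow> u \<in> U \<Longrightarrow> cj g u \<in> U) \<Longrightarrow> conj_closed P U"
  by (simp add: conj_closed_def)

lemma conj_closed_mono: "conj_closed P U \<Longrightarrow> P' \<subseteq> P \<Longrightarrow> conj_closed P' U"
  by (auto simp: conj_closed_def)

text \<open>Both \<open>g\<close> and \<open>- g\<close> must preserve \<open>U\<close>: conjugation
  can map an infinite subgroup properly into itself, and only the two-sided condition is closed
  under negation.\<close>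

lemma add_subgroup_normalizer:
  assumes "add_subgroup U"
  shows "add_subgroup {g. (\<forall>u\<in>U. cj g u \<in> U) \<and> (\<forall>u\<in>U. cj (- g) u \<in> U)}"
  by (rule add_subgroupI) (auto simp: minus_add cj_cj cj_cj_diff)

definition normal_sub :: "'g::group_add set \<Rightarrow> bool" where
  "normal_sub N \<longleftrightarrow> add_subgroup N \<and> conj_closed UNIV N"

lemma normal_subD:
  assumes "normal_sub N"
  shows "add_subgroup N" "conj_closed P N" "u \<in> N \<Longrightarrow> cj g u \<in> N"
  using assms conj_closed_mono[of UNIV N P] by (auto simp: normal_sub_def conj_closed_def)

lemma normal_sub_comm:
  assumes "normal_sub N" "x \<in> N \<or> y \<in> N"
  shows "comm x y \<in> N"
proof -
  have "comm x y = cj x y - y" "comm x y = x + cj y (- x)"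
    by (simp_all add: comm_def cj_def group_norm del: add_uminus_conv_diff)
  then show ?thesis
    using assms normal_subD[OF assms(1)] add_subgroupD[OF normal_subD(1)[OF assms(1)]] by metis
qed

lemma normal_sub_Int: "normal_sub M \<Longrightarrow> normal_sub N \<Longrightarrow> normal_sub (M \<inter> N)"
  by (simp add: normal_sub_def add_subgroup_def conj_closed_def)

text \<open>The operator-closed hull: \<open>P = {}\<close> gives generated subgroups, \<open>P = UNIV\<close> normal closures,
  and in general submodules of an abelian section on which \<open>P\<close> acts by conjugation.\<close>

inductive_set op_hull :: "'g::group_add set \<Rightarrow> 'g set \<Rightarrow> 'g set" for P X where
  zero: "0 \<in> op_hull P X"
| base: "x \<in> X \<Longrightarrow> x \<in> op_hull P X"
| add: "x \<in> op_hull P X \<Longrightarrow> y \<in> op_hull P X \<Longrightarrow> x + y \<in> op_hull P X"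
| minus: "x \<in> op_hull P X \<Longrightarrow> - x \<in> op_hull P X"
| conj: "g \<in> P \<Longrightarrow> x \<in> op_hull P X \<Longrightarrow> cj g x \<in> op_hull P X"

abbreviation gen :: "'g::group_add set \<Rightarrow> 'g set" where "gen \<equiv> op_hull {}"
abbreviation ncl :: "'g::group_add set \<Rightarrow> 'g set" where "ncl \<equiv> op_hull UNIV"

lemma add_subgroup_hull: "add_subgroup (op_hull P X)"
  by (auto intro: add_subgroupI op_hull.intros)

lemma conj_closed_hull: "conj_closed P (op_hull P X)"
  by (auto intro: conj_closedI op_hull.intros)

lemma normal_sub_ncl: "normal_sub (ncl X)"
  by (simp add: normal_sub_def add_subgroup_hull conj_closed_hull)

lemma hull_least:
  assumes "add_subgroup U" "conj_closed P U" "X \<subseteq> U"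
  shows "op_hull P X \<subseteq> U"
proof
  fix x assume "x \<in> op_hull P X"
  then show "x \<in> U"
    by induction (use assms in \<open>auto dest: add_subgroupD conj_closedD\<close>)
qed

lemma gen_least: "add_subgroup U \<Longrightarrow> X \<subseteq> U \<Longrightarrow> gen X \<subseteq> U"
  by (rule hull_least) (auto simp: conj_closed_def)

lemma ncl_least: "normal_sub U \<Longrightarrow> X \<subseteq> U \<Longrightarrow> ncl X \<subseteq> U"
  by (rule hull_least) (auto simp: normal_sub_def)

lemma subset_hull: "X \<subseteq> op_hull P X"
  by (auto intro: op_hull.base)

lemma hull_mono: "P \<subseteq> P' \<Longrightarrow> X \<subseteq> X' \<Longrightarrow> op_hull P X \<subseteq> op_hull P' X'"
  by (rule hull_least)
    (auto intro: add_subgroup_hull conj_closed_mono[OF conj_closed_hull] op_hull.base)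

lemma gen_normalizes:
  assumes "add_subgroup U" and "\<And>g u. g \<in> Y \<Longrightarrow> u \<in> U \<Longrightarrow> cj g u \<in> U \<and> cj (- g) u \<in> U"
  shows "conj_closed (gen Y) U"
proof -
  have "gen Y \<subseteq> {g. (\<forall>u\<in>U. cj g u \<in> U) \<and> (\<forall>u\<in>U. cj (- g) u \<in> U)}"
    by (rule gen_least[OF add_subgroup_normalizer[OF assms(1)]]) (use assms(2) in auto)
  then show ?thesis by (auto simp: conj_closed_def)
qed

lemma add_subgroup_plus:
  assumes A: "add_subgroup A" and B: "add_subgroup B" and AB: "conj_closed A B"
  shows "add_subgroup (A + B)"
proof (rule add_subgroupI)
  show "0 \<in> A + B"
    using add_subgroupD(1)[OF A] add_subgroupD(1)[OF B] by (metis add_0 set_plus_intro)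
next
  fix x y assume "x \<in> A + B" "y \<in> A + B"
  then obtain a b a' b' where *: "a \<in> A" "b \<in> B" "a' \<in> A" "b' \<in> B" "x = a + b" "y = a' + b'"
    by (meson set_plus_elim)
  have "x + y = (a + a') + (cj (- a') b + b')"
    using * by (simp add: cj_def group_norm del: add_uminus_conv_diff)
  moreover have "cj (- a') b \<in> B"
    using * A AB by (meson add_subgroupD(3) conj_closedD)
  ultimately show "x + y \<in> A + B"
    using * A B by (metis add_subgroupD(2) set_plus_intro)
next
  fix x assume "x \<in> A + B"
  then obtain a b where *: "a \<in> A" "b \<in> B" "x = a + b"
    by (meson set_plus_elim)
  have "- x = (- a) + cj a (- b)"
    using * by (simp add: cj_def group_norm del: add_uminus_conv_diff)
  moreover have "cj a (- b) \<in> B"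
    using * B AB by (meson add_subgroupD(3) conj_closedD)
  ultimately show "- x \<in> A + B"
    using * A by (metis add_subgroupD(3) set_plus_intro)
qed

lemma conj_closed_plus:
  assumes "conj_closed P A" "conj_closed P B"
  shows "conj_closed P (A + B)"
proof (rule conj_closedI)
  fix g u assume "g \<in> P" "u \<in> A + B"
  then obtain a b where "a \<in> A" "b \<in> B" "u = a + b" by (meson set_plus_elim)
  then show "cj g u \<in> A + B"
    using assms \<open>g \<in> P\<close> by (metis cj_add conj_closedD set_plus_intro)
qed

lemma normal_sub_plus: "normal_sub A \<Longrightarrow> normal_sub B \<Longrightarrow> normal_sub (A + B)"
  unfolding normal_sub_def
  by (auto intro!: add_subgroup_plus conj_closed_plus intro: conj_closed_mono)

lemma subset_plus_left: "add_subgroup B \<Longrightarrow> A \<subseteq> A + B"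
  using add_subgroupD(1)[of B] by (metis add_0_right set_plus_intro subsetI)

lemma subset_plus_right: "add_subgroup A \<Longrightarrow> B \<subseteq> A + B"
  using add_subgroupD(1)[of A] by (metis add_0 set_plus_intro subsetI)

lemma plus_least: "add_subgroup U \<Longrightarrow> A \<subseteq> U \<Longrightarrow> B \<subseteq> U \<Longrightarrow> A + B \<subseteq> U"
  by (auto elim!: set_plus_elim dest: add_subgroupD)

text \<open>These are the \<open>P\<close>-submodules of \<open>E\<close> modulo \<open>S\<close>,
  represented by their preimages so that no quotient is formed.\<close>

definition op_sub :: "'g::group_add set \<Rightarrow> 'g set \<Rightarrow> 'g set \<Rightarrow> 'g set \<Rightarrow> bool" where
  "op_sub S E P U \<longleftrightarrow> add_subgroup U \<and> S \<subseteq> U \<and> U \<subseteq> E \<and> conj_closed P U"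

text \<open>Only submodules of finitely generated submodules are tested: \<open>E\<close> modulo
  \<open>S\<close> may fail to be finitely generated over the small operator sets from which Hall's
  induction starts.\<close>

definition noetherian :: "'g::group_add set \<Rightarrow> 'g set \<Rightarrow> 'g set \<Rightarrow> bool" where
  "noetherian S E P \<longleftrightarrow> (\<forall>X U. finite X \<longrightarrow> X \<subseteq> E \<longrightarrow> op_sub S E P U \<longrightarrow> U \<subseteq> op_hull P (X \<union> S) \<longrightarrow>
     (\<exists>X'. finite X' \<and> X' \<subseteq> U \<and> U \<subseteq> op_hull P (X' \<union> S)))"

section \<open>Submodules and congruences in an abelian section\<close>

locale abelian_section =
  fixes E S :: "'g::group_add set"
  assumes nE: "normal_sub E" and nS: "normal_sub S" and SE: "S \<subseteq> E"
    and comm_S: "\<And>x y. x \<in> E \<Longrightarrow> y \<in> E \<Longrightarrow> comm x y \<in> S"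
begin

lemma op_sub_hull:
  assumes "X \<subseteq> E" shows "op_sub S E P (op_hull P (X \<union> S))"
proof -
  have "op_hull P (X \<union> S) \<subseteq> E"
    using hull_least[of E P "X \<union> S"] assms nE SE by (simp add: normal_subD)
  then show ?thesis
    using subset_hull[of "X \<union> S" P] by (auto simp: op_sub_def add_subgroup_hull conj_closed_hull)
qed

text \<open>\<open>E\<close> acts trivially on the abelian quotient by \<open>S\<close>, so all
  subgroups between \<open>S\<close> and \<open>E\<close> are normalized by
  \<open>E\<close>.\<close>

lemma cj_E_mem:
  assumes "op_sub S E P U" "x \<in> E" "u \<in> U" shows "cj x u \<in> U"
proof -
  have "comm x u \<in> U" using assms comm_S unfolding op_sub_def by blast
  then show ?thesis using assms by (auto simp: cj_eq_comm op_sub_def dest: add_subgroupD)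
qed

lemma op_sub_empty: "op_sub S E P U \<Longrightarrow> op_sub S E {} U"
  by (auto simp: op_sub_def conj_closed_def)

lemma swap:
  assumes "op_sub S E P U" "x \<in> E" "x + y \<in> U" shows "y + x \<in> U"
proof -
  have "y + x = cj (- x) (x + y)" by (simp add: cj_def group_norm del: add_uminus_conv_diff)
  then show ?thesis using assms cj_E_mem[OF assms(1), of "- x"] nE
    by (metis add_subgroupD(3) normal_subD(1))
qed

lemma cong_add:
  assumes U: "op_sub S E P U" and x: "x \<in> E" and d: "x - y \<in> U" "x' - y' \<in> U"
  shows "(x + x') - (y + y') \<in> U"
proof -
  have "(x + x') - (y + y') = cj x (x' - y') + (x - y)"
    by (simp add: cj_def group_norm del: add_uminus_conv_diff)
  then show ?thesis using cj_E_mem[OF U x d(2)] d(1) U by (auto simp: op_sub_def dest: add_subgroupD)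
qed

lemma cong_minus:
  assumes U: "op_sub S E P U" and x: "y \<in> E" and d: "x - y \<in> U"
  shows "(- x) - (- y) \<in> U"
proof -
  have y: "- y \<in> E" using x nE by (meson add_subgroupD(3) normal_subD(1))
  have "- (x - y) \<in> U" using U d by (auto simp: op_sub_def dest: add_subgroupD)
  then have "y + (- x) \<in> U" by simp
  then have "- x + y \<in> U" using swap[OF U x] by blast
  then show ?thesis by simp
qed

lemma op_sub_plus:
  assumes "op_sub S E P U" "op_sub S E P V" shows "op_sub S E P (U + V)"
proof -
  have "conj_closed U V"
    using assms(1) cj_E_mem[OF assms(2)] by (auto simp: conj_closed_def op_sub_def)
  then have "add_subgroup (U + V)" using assms by (auto intro: add_subgroup_plus simp: op_sub_def)
  moreover have "S \<subseteq> U + V" using assms subset_plus_left[of V U] by (auto simp: op_sub_def)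
  moreover have "U + V \<subseteq> E"
    using assms nE plus_least[of E U V] by (auto simp: op_sub_def normal_sub_def)
  ultimately show ?thesis
    using assms conj_closed_plus[of P U V] by (auto simp: op_sub_def)
qed

end

section \<open>Hall's noetherian argument\<close>

context abelian_section
begin

text \<open>An operator \<open>p\<close> acts on the translate by \<open>g\<close> as its conjugate
  \<open>cj (- g) p\<close> acts on \<open>V\<close>; hence the condition on
  \<open>P\<close>.\<close>

lemma op_sub_image:
  assumes V: "op_sub S E P V" and P: "\<And>p. p \<in> P \<Longrightarrow> cj (- g) p \<in> P"
  shows "op_sub S E P (cj g ` V)"
proof -
  have sub: "add_subgroup V" "S \<subseteq> V" "V \<subseteq> E" "conj_closed P V"
    using V by (auto simp: op_sub_def)
  have "add_subgroup (cj g ` V)"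
    using add_subgroupD[OF sub(1)]
    by (intro add_subgroupI) (auto simp: cj_add[symmetric] cj_minus[symmetric] intro: rev_image_eqI[of 0])
  moreover have "S \<subseteq> cj g ` V"
  proof
    fix s assume "s \<in> S"
    then have "cj (- g) s \<in> V" using nS sub(2) by (auto dest: normal_subD(3))
    then show "s \<in> cj g ` V" by (rule rev_image_eqI) simp
  qed
  moreover have "cj g ` V \<subseteq> E" using sub(3) nE by (auto dest: normal_subD(3))
  moreover have "conj_closed P (cj g ` V)"
  proof (rule conj_closedI)
    fix p u assume p: "p \<in> P" and "u \<in> cj g ` V"
    then obtain v where v: "v \<in> V" "u = cj g v" by blast
    have "cj p u = cj g (cj (cj (- g) p) v)"
      using cj_cj_left[of g "cj (- g) p" v] v by simp
    then show "cj p u \<in> cj g ` V"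
      using v p P sub(4) by (auto dest: conj_closedD)
  qed
  ultimately show ?thesis by (simp add: op_sub_def)
qed

end

primrec mul :: "nat \<Rightarrow> 'g::group_add \<Rightarrow> 'g" where
  "mul 0 t = 0"
| "mul (Suc n) t = t + mul n t"

lemma mul_add: "mul (m + n) t = mul m t + mul n t"
  by (induction m) (simp_all add: add.assoc)

text \<open>The twisted polynomial setting of P. Hall's proof of the Hilbert basis theorem:
  \<open>bounded k\<close> plays the role of the polynomials of degree below \<open>k\<close> in \<open>t\<close> with coefficients
  in \<open>W\<close>, and \<open>lead G k\<close> that of the leading coefficients of degree \<open>k\<close> in \<open>G\<close>.\<close>

locale hall_extension = abelian_section E S for E S :: "'g::group_add set" +
  fixes P :: "'g set" and t :: 'g and W :: "'g set"
  assumes P_conj: "\<And>p. p \<in> P \<Longrightarrow> cj t p \<in> P" "\<And>p. p \<in> P \<Longrightarrow> cj (- t) p \<in> P"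
    and W: "op_sub S E P W"
begin

primrec bounded :: "nat \<Rightarrow> 'g set" where
  "bounded 0 = S"
| "bounded (Suc k) = bounded k + cj (mul k t) ` W"

definition lead :: "'g set \<Rightarrow> nat \<Rightarrow> 'g set" where
  "lead G k = {w \<in> W. \<exists>u\<in>G. u - cj (mul k t) w \<in> bounded k}"

lemma P_conj_mul: "p \<in> P \<Longrightarrow> cj (mul k t) p \<in> P" "p \<in> P \<Longrightarrow> cj (- mul k t) p \<in> P"
proof -
  show "p \<in> P \<Longrightarrow> cj (mul k t) p \<in> P" by (induction k) (auto simp: cj_cj P_conj)
  show "p \<in> P \<Longrightarrow> cj (- mul k t) p \<in> P"
    by (induction k arbitrary: p) (auto simp: cj_cj_diff minus_add P_conj)
qed

lemma op_sub_S: "op_sub S E P S"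
  using nS SE normal_subD[OF nS] by (auto simp: op_sub_def)

lemma op_sub_bounded: "op_sub S E P (bounded k)"
  by (induction k) (auto simp: op_sub_S intro!: op_sub_plus op_sub_image W P_conj_mul)

lemmas bounded_sub = op_sub_bounded[unfolded op_sub_def, THEN conjunct1]

lemma W_E: "w \<in> W \<Longrightarrow> w \<in> E" "w \<in> W \<Longrightarrow> cj g w \<in> E"
  using W nE by (auto simp: op_sub_def dest: normal_subD(3))

lemma bounded_Suc_mono: "bounded k \<subseteq> bounded (Suc k)"
proof -
  have "op_sub S E P (cj (mul k t) ` W)" by (intro op_sub_image W P_conj_mul)
  then show ?thesis by (auto simp: op_sub_def intro!: subset_plus_left)
qed

lemma bounded_mono: "k \<le> l \<Longrightarrow> bounded k \<subseteq> bounded l"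
  by (rule lift_Suc_mono_le[of bounded]) (use bounded_Suc_mono in auto)

lemma cj_bounded: "u \<in> bounded k \<Longrightarrow> cj t u \<in> bounded (Suc k)"
proof (induction k arbitrary: u)
  case 0
  then show ?case
    using bounded_Suc_mono[of 0] nS by (auto dest: normal_subD(3))
next
  case (Suc k)
  then obtain a w where *: "a \<in> bounded k" "w \<in> W" "u = a + cj (mul k t) w"
    by (auto elim: set_plus_elim)
  have "cj t u = cj t a + cj (mul (Suc k) t) w"
    using * by (simp add: cj_add cj_cj)
  then show ?case
    using * Suc.IH[of a] by (metis bounded.simps(2) imageI set_plus_intro)
qed

lemma op_sub_lead:
  assumes G: "op_sub S E P G" shows "op_sub S E P (lead G k)"
proof -
  let ?c = "cj (mul k t)"
  note G' = G[unfolded op_sub_def] and W' = W[unfolded op_sub_def] and B = op_sub_bounded[of k]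
  note B' = B[unfolded op_sub_def]
  have GE: "u \<in> G \<Longrightarrow> u \<in> E" for u using G' by auto
  have "add_subgroup (lead G k)"
  proof (rule add_subgroupI)
    have "0 \<in> W" "0 \<in> G" "0 \<in> bounded k" using G' W' B' by (auto dest: add_subgroupD)
    then show "0 \<in> lead G k" by (auto simp: lead_def intro!: bexI[of _ 0])
  next
    fix x y assume "x \<in> lead G k" "y \<in> lead G k"
    then obtain u v where *: "x \<in> W" "y \<in> W" "u \<in> G" "v \<in> G"
        "u - ?c x \<in> bounded k" "v - ?c y \<in> bounded k"
      by (auto simp: lead_def)
    then have "u + v - ?c (x + y) \<in> bounded k"
      using cong_add[OF B GE] by (simp add: cj_add)
    then show "x + y \<in> lead G k"
      using * G' W' by (auto simp: lead_def dest: add_subgroupD)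
  next
    fix x assume "x \<in> lead G k"
    then obtain u where *: "x \<in> W" "u \<in> G" "u - ?c x \<in> bounded k"
      by (auto simp: lead_def)
    then have "- u - ?c (- x) \<in> bounded k"
      using cong_minus[OF B W_E(2)] by (simp add: cj_minus)
    then show "- x \<in> lead G k"
      using * G' W' by (auto simp: lead_def dest: add_subgroupD)
  qed
  moreover have "S \<subseteq> lead G k"
  proof
    fix s assume s: "s \<in> S"
    then have "?c s \<in> S" using nS by (auto dest: normal_subD(3))
    moreover have "?c s - ?c s \<in> bounded k" using B' by (auto dest: add_subgroupD(1))
    ultimately show "s \<in> lead G k" using s G' W' unfolding lead_def by blast
  qed
  moreover have "lead G k \<subseteq> E" using W' by (auto simp: lead_def)
  moreover have "conj_closed P (lead G k)"
  proof (rule conj_closedI)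
    fix p x assume p: "p \<in> P" and "x \<in> lead G k"
    then obtain u where *: "x \<in> W" "u \<in> G" "u - ?c x \<in> bounded k"
      by (auto simp: lead_def)
    \<comment> \<open>Twisted coefficients: to make \<open>p\<close> act on the leading coefficient,
      its conjugate by the \<open>k\<close>-th power of \<open>t\<close> has to act on the
      polynomial \<open>u\<close>.\<close>
    have p': "?c p \<in> P" using p P_conj_mul by blast
    have "cj (?c p) u - ?c (cj p x) = cj (?c p) (u - ?c x)"
      by (simp add: cj_diff cj_cj_left)
    then have "cj (?c p) u - ?c (cj p x) \<in> bounded k"
      using p' * B' by (auto dest: conj_closedD)
    moreover have "cj (?c p) u \<in> G" "cj p x \<in> W"
      using p' p * G' W' by (auto dest: conj_closedD)
    ultimately show "cj p x \<in> lead G k" by (auto simp: lead_def)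
  qed
  ultimately show ?thesis by (simp add: op_sub_def)
qed

text \<open>Multiplying a polynomial by \<open>t\<close> keeps its leading coefficient and raises
  the degree by one.\<close>

lemma lead_Suc_mono:
  assumes "conj_closed {t} G" shows "lead G k \<subseteq> lead G (Suc k)"
proof
  fix x assume "x \<in> lead G k"
  then obtain u where *: "x \<in> W" "u \<in> G" "u - cj (mul k t) x \<in> bounded k"
    by (auto simp: lead_def)
  have "cj t u - cj (mul (Suc k) t) x = cj t (u - cj (mul k t) x)"
    by (simp add: cj_diff cj_cj)
  then have "cj t u - cj (mul (Suc k) t) x \<in> bounded (Suc k)"
    using cj_bounded[OF *(3)] by metis
  moreover have "cj t u \<in> G" using assms *(2) by (simp add: conj_closed_def)
  ultimately show "x \<in> lead G (Suc k)" using *(1) unfolding lead_def by blast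
qed

lemma lead_mono:
  assumes "conj_closed {t} G" "k \<le> l" shows "lead G k \<subseteq> lead G l"
  by (rule lift_Suc_mono_le[of "lead G"]) (use lead_Suc_mono assms in auto)

text \<open>Division by leading terms: an element of degree \<open>k\<close> shares its leading
  coefficient with some element of \<open>G\<close>, and the difference has lower degree.\<close>

lemma bounded_subset_of_lead:
  assumes U: "op_sub S E P U" and G: "op_sub S E P G" "G \<subseteq> U"
    and le: "\<And>k. lead U k \<subseteq> lead G k"
  shows "U \<inter> bounded k \<subseteq> G"
proof (induction k)
  case 0
  then show ?case using G by (auto simp: op_sub_def)
next
  case (Suc k)
  show ?case
  proof
    fix u assume u: "u \<in> U \<inter> bounded (Suc k)"
    then obtain a w where *: "a \<in> bounded k" "w \<in> W" "u = a + cj (mul k t) w"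
      by (auto elim: set_plus_elim)
    have "u - cj (mul k t) w = a" using * by simp
    then have "w \<in> lead U k" using * u unfolding lead_def by blast
    then have "w \<in> lead G k" using le by blast
    then obtain g where g: "g \<in> G" "g - cj (mul k t) w \<in> bounded k"
      by (auto simp: lead_def)
    have "u - g = a - (g - cj (mul k t) w)"
      using * by (simp add: group_norm del: add_uminus_conv_diff)
    then have "u - g \<in> bounded k" using * g bounded_sub by (metis add_subgroupD(4))
    moreover have "u - g \<in> U" using u g G U by (auto simp: op_sub_def dest: add_subgroupD(4))
    ultimately have "u - g \<in> G" using Suc by blast
    then show "u \<in> G" using add_subgroupD(2)[of G "u - g" g] g G by (simp add: op_sub_def)
  qed
qed

text \<open>A Laurent polynomial in \<open>t\<close> becomes a polynomial after multiplication by a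
  high power of \<open>t\<close>; this takes care of the operator \<open>- t\<close>.\<close>

lemma shift_into_bounded:
  assumes "u \<in> op_hull (insert t (insert (- t) P)) W"
  shows "\<exists>n k. cj (mul n t) u \<in> bounded k"
proof -
  let ?H = "{u. \<exists>n k. cj (mul n t) u \<in> bounded k}"
  have up: "cj (mul (m + n) t) u \<in> bounded (m + k)" if "cj (mul n t) u \<in> bounded k" for m n k u
    by (induction m) (use that cj_bounded in \<open>auto simp: cj_cj\<close>)
  have "add_subgroup ?H"
  proof (rule add_subgroupI)
    show "0 \<in> ?H" using bounded_sub add_subgroupD(1) by fastforce
  next
    fix x y assume "x \<in> ?H" "y \<in> ?H"
    then obtain n k m l where "cj (mul n t) x \<in> bounded k" "cj (mul m t) y \<in> bounded l" by auto
    then have "cj (mul (m + n) t) x \<in> bounded (m + k)" "cj (mul (m + n) t) y \<in> bounded (n + l)"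
      using up[of n x k m] up[of m y l n] by (simp_all add: add.commute)
    then have "cj (mul (m + n) t) x \<in> bounded (m + k + (n + l))"
        "cj (mul (m + n) t) y \<in> bounded (m + k + (n + l))"
      using bounded_mono[of "m + k" "m + k + (n + l)"] bounded_mono[of "n + l" "m + k + (n + l)"] by auto
    then have "cj (mul (m + n) t) (x + y) \<in> bounded (m + k + (n + l))"
      using bounded_sub by (auto simp: cj_add dest: add_subgroupD)
    then show "x + y \<in> ?H" by blast
  next
    fix x assume "x \<in> ?H"
    then show "- x \<in> ?H" using bounded_sub by (auto simp: cj_minus dest: add_subgroupD)
  qed
  moreover have "conj_closed (insert t (insert (- t) P)) ?H"
  proof (rule conj_closedI)
    fix g u assume g: "g \<in> insert t (insert (- t) P)" and "u \<in> ?H"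
    then obtain n k where u: "cj (mul n t) u \<in> bounded k" by auto
    have comm: "t + mul n t = mul n t + t" for n
      using mul_add[of n 1 t] mul_add[of 1 n t] by (simp add: add.commute)
    from g consider "g = t" | "g = - t" | "g \<in> P" by blast
    then show "cj g u \<in> ?H"
    proof cases
      case 1
      have "cj (mul n t) (cj t u) = cj t (cj (mul n t) u)" by (metis cj_cj comm)
      then have "cj (mul n t) (cj g u) \<in> bounded (Suc k)" using 1 cj_bounded[OF u] by metis
      then show ?thesis by blast
    next
      case 2
      have "cj (mul (Suc n) t) (cj (- t) u) = cj (mul n t) u"
        by (metis cj_cj cj_inv' comm mul.simps(2))
      then have "cj (mul (Suc n) t) (cj g u) \<in> bounded k" using 2 u by metis
      then show ?thesis by blast
    next
      case 3
      have "cj (mul n t) (cj g u) = cj (cj (mul n t) g) (cj (mul n t) u)"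
        by (simp add: cj_cj_left)
      then have "cj (mul n t) (cj g u) \<in> bounded k"
        using op_sub_bounded[of k] P_conj_mul(1)[OF 3, of n] u by (auto simp: op_sub_def dest: conj_closedD)
      then show ?thesis by blast
    qed
  qed
  moreover have "W \<subseteq> ?H"
  proof
    fix w assume "w \<in> W"
    moreover have "0 \<in> S" using nS by (auto simp: normal_sub_def dest: add_subgroupD)
    ultimately have "0 + cj (mul 0 t) w \<in> bounded (Suc 0)"
      by (metis bounded.simps imageI set_plus_intro)
    then have "cj (mul 0 t) w \<in> bounded (Suc 0)" by simp
    then show "w \<in> ?H" by blast
  qed
  ultimately have "op_hull (insert t (insert (- t) P)) W \<subseteq> ?H" by (rule hull_least)
  then show ?thesis using assms by blast
qed

end

context abelian_section
begin

lemma op_sub_mono: "op_sub S E P U \<Longrightarrow> P' \<subseteq> P \<Longrightarrow> op_sub S E P' U"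
  by (auto simp: op_sub_def intro: conj_closed_mono)

lemma hull_S_least: "op_sub S E P U \<Longrightarrow> X \<subseteq> U \<Longrightarrow> op_hull P (X \<union> S) \<subseteq> U"
  by (rule hull_least) (auto simp: op_sub_def)

text \<open>Hilbert's basis theorem for twisted Laurent polynomials with coefficients in the
  \<open>P\<close>-module spanned by \<open>X\<close>. The leading-coefficient modules of
  \<open>U\<close> increase with the degree and become stationary, so lifts of finitely many leading
  coefficients generate \<open>U\<close>.\<close>

lemma noetherian_insert:
  assumes N: "noetherian S E P"
    and P: "\<And>p. p \<in> P \<Longrightarrow> cj t p \<in> P" "\<And>p. p \<in> P \<Longrightarrow> cj (- t) p \<in> P"
  shows "noetherian S E (insert t (insert (- t) P))" (is "noetherian S E ?Q")
  unfolding noetherian_def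
proof (intro allI impI)
  fix X U assume X: "finite X" "X \<subseteq> E" and U: "op_sub S E ?Q U" and UX: "U \<subseteq> op_hull ?Q (X \<union> S)"
  let ?W = "op_hull P (X \<union> S)"
  interpret hall_extension E S P t ?W
    by unfold_locales (use P op_sub_hull[OF X(2)] in auto)
  have UP: "op_sub S E P U" by (rule op_sub_mono[OF U]) auto
  have Ut: "conj_closed {t} U" using U by (auto simp: op_sub_def intro: conj_closed_mono)
  have fin: "\<exists>X'. finite X' \<and> X' \<subseteq> V \<and> V \<subseteq> op_hull P (X' \<union> S)"
    if "op_sub S E P V" "V \<subseteq> ?W" for V
    using N X that unfolding noetherian_def by blast
  \<comment> \<open>The union of the ascending chain of leading-coefficient modules. It lies in
    \<open>?W\<close>, so finitely many elements generate it, and they all occur at one stage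
    \<open>K\<close>.\<close>
  define L where "L = (\<Union>k. lead U k)"
  have LE: "op_sub S E P (lead U k)" for k by (rule op_sub_lead[OF UP])
  have Lmono: "k \<le> l \<Longrightarrow> lead U k \<subseteq> lead U l" for k l by (rule lead_mono[OF Ut])
  have "add_subgroup L"
  proof (rule add_subgroupI)
    show "0 \<in> L" using LE[of 0] by (auto simp: L_def op_sub_def dest: add_subgroupD(1))
  next
    fix x y assume "x \<in> L" "y \<in> L"
    then obtain k l where "x \<in> lead U k" "y \<in> lead U l" by (auto simp: L_def)
    then have "x \<in> lead U (max k l)" "y \<in> lead U (max k l)"
      using Lmono[of k "max k l"] Lmono[of l "max k l"] by auto
    then have "x + y \<in> lead U (max k l)"
      using LE[of "max k l"] by (auto simp: op_sub_def dest: add_subgroupD(2))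
    then show "x + y \<in> L" by (auto simp: L_def)
  next
    fix x assume "x \<in> L"
    then show "- x \<in> L" using LE by (fastforce simp: L_def op_sub_def dest: add_subgroupD(3))
  qed
  then have LP: "op_sub S E P L"
    using LE by (fastforce simp: op_sub_def L_def conj_closed_def)
  have "L \<subseteq> ?W" by (auto simp: L_def lead_def)
  from fin[OF LP this] obtain Y where Y: "finite Y" "Y \<subseteq> L" "L \<subseteq> op_hull P (Y \<union> S)"
    by (elim exE conjE)
  have "\<forall>y\<in>Y. \<exists>k. y \<in> lead U k" using Y by (auto simp: L_def)
  then obtain f where f: "\<And>y. y \<in> Y \<Longrightarrow> y \<in> lead U (f y)" by metis
  define K where "K = (\<Sum>y\<in>Y. f y)"
  have "y \<in> lead U K" if "y \<in> Y" for y
    using f[OF that] Lmono[of "f y" K] member_le_sum[of y Y f] that Y(1) by (auto simp: K_def)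
  then have LK: "L \<subseteq> lead U K" using Y(3) hull_S_least[OF LE, of Y K] by blast
  have "\<forall>k. \<exists>X'. finite X' \<and> X' \<subseteq> lead U k \<and> lead U k \<subseteq> op_hull P (X' \<union> S)"
    using fin LE by (auto simp: lead_def)
  then obtain Xk where Xk: "\<And>k. finite (Xk k)" "\<And>k. Xk k \<subseteq> lead U k"
      "\<And>k. lead U k \<subseteq> op_hull P (Xk k \<union> S)"
    by metis
  have "\<forall>k x. x \<in> Xk k \<longrightarrow> (\<exists>u\<in>U. u - cj (mul k t) x \<in> bounded k)"
    using Xk(2) by (auto simp: lead_def)
  then obtain h where h: "\<And>k x. x \<in> Xk k \<Longrightarrow> h k x \<in> U"
      "\<And>k x. x \<in> Xk k \<Longrightarrow> h k x - cj (mul k t) x \<in> bounded k"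
    by metis
  \<comment> \<open>Elements of \<open>U\<close> whose leading coefficients generate the leading
    modules in each degree up to \<open>K\<close>; above \<open>K\<close> nothing new
    appears.\<close>
  define X' where "X' = (\<Union>k\<le>K. h k ` Xk k)"
  define G where "G = op_hull ?Q (X' \<union> S)"
  have X': "finite X'" "X' \<subseteq> U" using Xk(1) h by (auto simp: X'_def)
  have X'E: "X' \<subseteq> E" using X' U by (auto simp: op_sub_def)
  have GQ: "op_sub S E ?Q G" unfolding G_def by (rule op_sub_hull[OF X'E])
  have GP: "op_sub S E P G" by (rule op_sub_mono[OF GQ]) auto
  have GU: "G \<subseteq> U" unfolding G_def using hull_S_least[OF U X'(2)] .
  have Gt: "conj_closed {t} G" using GQ by (auto simp: op_sub_def intro: conj_closed_mono)
  have leK: "lead U k \<subseteq> lead G k" if "k \<le> K" for k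
  proof -
    have "Xk k \<subseteq> lead G k"
    proof
      fix x assume x: "x \<in> Xk k"
      then have "h k x \<in> G"
        using that by (auto simp: G_def X'_def intro!: op_hull.base)
      then show "x \<in> lead G k" using h(2)[OF x] Xk(2) x by (auto simp: lead_def)
    qed
    then show ?thesis using Xk(3)[of k] hull_S_least[OF op_sub_lead[OF GP]] by blast
  qed
  have le: "lead U k \<subseteq> lead G k" for k
  proof (cases "k \<le> K")
    case False
    then have "lead G K \<subseteq> lead G k" using lead_mono[OF Gt, of K k] by simp
    moreover have "lead U k \<subseteq> L" by (auto simp: L_def)
    ultimately show ?thesis using leK[of K] LK by auto
  qed (rule leK)
  have bG: "U \<inter> bounded k \<subseteq> G" for k by (rule bounded_subset_of_lead[OF UP GP GU le])
  have "U \<subseteq> G"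
  proof
    fix u assume u: "u \<in> U"
    \<comment> \<open>Shift \<open>u\<close> by a power of \<open>t\<close> into the polynomials,
      where division by leading terms applies, then shift back inside \<open>G\<close>.\<close>
    have "op_hull ?Q (X \<union> S) \<subseteq> op_hull ?Q ?W"
      by (rule hull_mono) (auto intro: op_hull.base)
    then obtain n k where nk: "cj (mul n t) u \<in> bounded k"
      using u UX shift_into_bounded[of u] by blast
    have "cj (mul n t) u \<in> U"
      by (induction n) (use u U in \<open>auto simp: cj_cj op_sub_def dest: conj_closedD\<close>)
    then have "cj (mul n t) u \<in> G" using nk bG by blast
    moreover have "cj (mul n t) u \<in> G \<Longrightarrow> u \<in> G"
    proof (induction n)
      case (Suc n)
      then have "cj (- t) (cj t (cj (mul n t) u)) \<in> G"
        using GQ by (auto simp: cj_cj op_sub_def dest: conj_closedD)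
      then show ?case using Suc by simp
    qed simp
    ultimately show "u \<in> G" by blast
  qed
  then show "\<exists>X'. finite X' \<and> X' \<subseteq> U \<and> U \<subseteq> op_hull ?Q (X' \<union> S)"
    using X' by (auto simp: G_def)
qed

end

section \<open>Commutator calculus modulo a normal subgroup\<close>

lemma normal_sub_gen:
  assumes "conj_closed UNIV X" shows "normal_sub (gen X)"
proof -
  have "cj g x \<in> gen X" if "x \<in> gen X" for g x
    using that
  proof induction
    case (base x)
    then show ?case using assms by (auto simp: conj_closed_def intro: op_hull.base)
  qed (auto simp: cj_add cj_minus intro: op_hull.intros)
  then show ?thesis by (auto simp: normal_sub_def add_subgroup_hull conj_closed_def)
qed

lemma comm_add_left: "comm (h + k) g = cj h (comm k g) + comm h g"
  and comm_add_right: "comm h (g + k) = comm h g + cj g (comm h k)"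
  and comm_minus_left: "comm (- h) g = cj (- h) (- comm h g)"
  and cj_comm: "cj a (comm h g) = comm (cj a h) (cj a g)"
  by (simp_all add: comm_def cj_def group_norm del: add_uminus_conv_diff)

lemma comm_zero [simp]: "comm 0 g = 0" "comm g 0 = 0"
  by (simp_all add: comm_def)

lemma add_subgroup_centralizer:
  assumes "normal_sub N" shows "add_subgroup {h. \<forall>g\<in>G. comm h g \<in> N}"
  using add_subgroupD[OF normal_subD(1)[OF assms]] normal_subD(3)[OF assms]
  by (intro add_subgroupI) (auto simp: comm_add_left comm_minus_left)

text \<open>The centralizer modulo \<open>N\<close> of a conjugation-invariant set; its normality
  allows commutators to be checked on normal generators.\<close>

lemma normal_sub_centralizer:
  assumes N: "normal_sub N" and G: "conj_closed UNIV G"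
  shows "normal_sub {h. \<forall>g\<in>G. comm h g \<in> N}"
  unfolding normal_sub_def
proof (intro conjI conj_closedI)
  fix a h assume h: "h \<in> {h. \<forall>g\<in>G. comm h g \<in> N}"
  have "comm (cj a h) g \<in> N" if "g \<in> G" for g
  proof -
    have "cj (- a) g \<in> G" using G that by (auto simp: conj_closed_def)
    then have "cj a (comm h (cj (- a) g)) \<in> N" using h N normal_subD(3) by blast
    then show ?thesis by (simp add: cj_comm)
  qed
  then show "cj a h \<in> {h. \<forall>g\<in>G. comm h g \<in> N}" by simp
qed (rule add_subgroup_centralizer[OF N])

lemma comm_gen_mem:
  assumes "normal_sub N" "\<And>t g. t \<in> T \<Longrightarrow> g \<in> G \<Longrightarrow> comm t g \<in> N" "h \<in> gen T" "g \<in> G"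
  shows "comm h g \<in> N"
  using gen_least[OF add_subgroup_centralizer[OF assms(1), of G], of T] assms by auto

lemma comm_ncl_mem:
  assumes "normal_sub N" "conj_closed UNIV G" "\<And>t g. t \<in> T \<Longrightarrow> g \<in> G \<Longrightarrow> comm t g \<in> N"
    "h \<in> ncl T" "g \<in> G"
  shows "comm h g \<in> N"
  using ncl_least[OF normal_sub_centralizer[OF assms(1,2)], of T] assms by auto

lemma comm_swap_mem:
  assumes "normal_sub N" "comm x y \<in> N" shows "comm y x \<in> N"
  using assms by (metis add_subgroupD(3) comm_minus normal_subD(1))

text \<open>The elements of \<open>T\<close> are central modulo \<open>N\<close>, so conjugation
  moves \<open>gen T\<close> only by elements of \<open>N\<close>.\<close>

lemma normal_sub_gen_plus:
  assumes N: "normal_sub N" and T: "\<And>t g. t \<in> T \<Longrightarrow> comm t g \<in> N"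
  shows "normal_sub (gen T + N)"
proof -
  have "add_subgroup (gen T + N)"
    by (intro add_subgroup_plus add_subgroup_hull normal_subD[OF N])
  moreover have "cj g u \<in> gen T + N" if u: "u \<in> gen T + N" for g u
  proof -
    obtain a b where ab: "a \<in> gen T" "b \<in> N" "u = a + b" using u by (blast elim: set_plus_elim)
    have "cj g u = a + (comm (- a) g + cj g b)"
      using ab by (simp add: comm_def cj_def group_norm del: add_uminus_conv_diff)
    moreover have "comm (- a) g \<in> N"
      using comm_gen_mem[OF N, of T UNIV "- a" g] T op_hull.minus[OF ab(1)] by simp
    ultimately show ?thesis
      using ab normal_subD[OF N] by (metis add_subgroupD(2) set_plus_intro)
  qed
  ultimately show ?thesis by (auto simp: normal_sub_def conj_closed_def)
qed

section \<open>Noetherian operators under central extensions\<close>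

context abelian_section
begin

text \<open>Submodules for a negation-closed operator set are stable under the subgroup it
  generates, so passing to a set between \<open>P\<close> and \<open>gen P\<close> changes no
  hull.\<close>

lemma noetherian_cong:
  assumes N: "noetherian S E P" and P: "P \<subseteq> P'" "P' \<subseteq> gen P" "\<And>p. p \<in> P \<Longrightarrow> - p \<in> P"
  shows "noetherian S E P'"
  unfolding noetherian_def
proof (intro allI impI)
  fix X U assume X: "finite X" "X \<subseteq> E" and U: "op_sub S E P' U" and UX: "U \<subseteq> op_hull P' (X \<union> S)"
  have "conj_closed (gen P) (op_hull P (X \<union> S))"
    by (rule gen_normalizes) (auto intro: add_subgroup_hull op_hull.conj P(3))
  then have "op_hull P' (X \<union> S) \<subseteq> op_hull P (X \<union> S)"
    by (intro hull_least) (auto intro: add_subgroup_hull op_hull.base conj_closed_mono[OF _ P(2)])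
  then obtain X' where X': "finite X'" "X' \<subseteq> U" "U \<subseteq> op_hull P (X' \<union> S)"
    using N X UX op_sub_mono[OF U P(1)] unfolding noetherian_def by (meson order_trans)
  moreover have "op_hull P (X' \<union> S) \<subseteq> op_hull P' (X' \<union> S)"
    by (rule hull_mono) (use P in auto)
  ultimately show "\<exists>X'. finite X' \<and> X' \<subseteq> U \<and> U \<subseteq> op_hull P' (X' \<union> S)" by (meson order_trans)
qed

text \<open>The generators in \<open>T\<close> are adjoined one at a time. Being central modulo
  \<open>Q\<close>, they keep the operator group reached so far normal, as Hall's step
  requires.\<close>

lemma noetherian_central_extension:
  assumes Q: "normal_sub Q" "noetherian S E Q" and T: "finite T" "\<And>t g. t \<in> T \<Longrightarrow> comm t g \<in> Q"
  shows "noetherian S E (gen T + Q)"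
  using T
proof (induction T)
  case empty
  have sQ: "add_subgroup Q" using Q normal_subD by blast
  then have "gen {} \<subseteq> Q" by (rule gen_least) simp
  then have "gen {} + Q \<subseteq> Q" by (rule plus_least[OF sQ]) simp
  moreover have "Q \<subseteq> gen {} + Q" by (rule subset_plus_right[OF add_subgroup_hull])
  ultimately have "gen {} + Q = Q" by (rule equalityI)
  then show ?case using Q by simp
next
  case (insert t T)
  let ?P = "gen T + Q" and ?P' = "gen (insert t T) + Q"
  have nP: "normal_sub ?P" "normal_sub ?P'"
    using insert.prems by (auto intro!: normal_sub_gen_plus Q)
  have N: "noetherian S E ?P" using insert by auto
  have sQ: "add_subgroup Q" using Q normal_subD by blast
  show ?case
  proof (rule noetherian_cong[OF noetherian_insert[OF N, of t]])
    have "t \<in> gen (insert t T)" by (auto intro: op_hull.base)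
    then have t: "t \<in> ?P'" using subset_plus_left[OF sQ] by blast
    have "?P \<subseteq> ?P'" by (intro set_plus_mono2 hull_mono) auto
    then show sub: "insert t (insert (- t) ?P) \<subseteq> ?P'"
      using t add_subgroupD(3)[OF normal_subD(1)[OF nP(2)]] by auto
    have "gen (insert t T) \<subseteq> gen (insert t (insert (- t) ?P))"
    proof (rule gen_least[OF add_subgroup_hull])
      have "T \<subseteq> ?P" using subset_plus_left[OF sQ, of "gen T"] subset_hull[of T "{}"] by auto
      then show "insert t T \<subseteq> gen (insert t (insert (- t) ?P))" by (auto intro: op_hull.base)
    qed
    moreover have "Q \<subseteq> gen (insert t (insert (- t) ?P))"
      using subset_plus_right[OF add_subgroup_hull[of "{}" T], of Q] by (auto intro: op_hull.base)
    ultimately show "?P' \<subseteq> gen (insert t (insert (- t) ?P))"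
      by (rule plus_least[OF add_subgroup_hull])
  qed (use normal_subD(3)[OF nP(1)] add_subgroupD(3)[OF normal_subD(1)[OF nP(1)]] in auto)
qed

section \<open>Trivial actions and finitely generated abelian groups\<close>

lemma op_sub_trivial:
  assumes "\<And>p x. p \<in> P \<Longrightarrow> x \<in> E \<Longrightarrow> comm p x \<in> S" "op_sub S E {} U"
  shows "op_sub S E P U"
proof -
  have "cj p u \<in> U" if "p \<in> P" "u \<in> U" for p u
    using assms(1)[of p u] assms(2) that by (auto simp: op_sub_def cj_eq_comm dest: add_subgroupD(2))
  then show ?thesis using assms(2) by (auto simp: op_sub_def conj_closed_def)
qed

lemma mul_E: "x \<in> E \<Longrightarrow> mul n x \<in> E"
  using add_subgroupD[OF normal_subD(1)[OF nE]] by (induction n) auto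

text \<open>Modulo \<open>X\<close> and \<open>S\<close> the quotient is cyclic, generated by
  \<open>x\<close>. Negative multiples are expressed through \<open>- b\<close>, since
  \<open>mul\<close> takes natural numbers.\<close>

lemma gen_insert_multiple:
  assumes X: "X \<subseteq> E" "x \<in> E" and b: "b \<in> gen (insert x X \<union> S)"
  shows "\<exists>n. b - mul n x \<in> gen (X \<union> S) \<or> - b - mul n x \<in> gen (X \<union> S)"
proof -
  let ?A = "gen (X \<union> S)"
  \<comment> \<open>Allowing multiples of \<open>x\<close> on both sides makes this a subgroup
    without integer multiples; the smaller of \<open>m\<close> and \<open>n\<close> is cancelled at
    the end.\<close>
  define H where "H = {b \<in> E. \<exists>m n. (b + mul m x) - mul n x \<in> ?A}"
  have A: "op_sub S E {} ?A" by (rule op_sub_hull[OF X(1)])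
  note A' = A[unfolded op_sub_def]
  note E' = add_subgroupD[OF normal_subD(1)[OF nE]]
  have "add_subgroup H"
  proof (rule add_subgroupI)
    have "(0 + mul 0 x) - mul 0 x \<in> ?A" by (auto intro: op_hull.zero)
    then show "0 \<in> H" using E' unfolding H_def by blast
  next
    fix b c assume "b \<in> H" "c \<in> H"
    then obtain m n m' n' where *: "b \<in> E" "c \<in> E"
        "(b + mul m x) - mul n x \<in> ?A" "(c + mul m' x) - mul n' x \<in> ?A"
      unfolding H_def by blast
    have "b + mul m x \<in> E" using * mul_E[OF X(2)] E' by blast
    then have 1: "(b + mul m x) + (c + mul m' x) - (mul n x + mul n' x) \<in> ?A"
      using cong_add[OF A _ *(3,4)] by blast
    have "cj b (comm c (mul m x)) \<in> ?A"
      using comm_S[OF *(2) mul_E[OF X(2)]] nS A' by (auto dest: normal_subD(3))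
    from op_hull.add[OF this 1]
    have "(b + c + mul (m + m') x) - mul (n + n') x \<in> ?A"
      by (simp add: mul_add cj_def comm_def group_norm del: add_uminus_conv_diff)
    then show "b + c \<in> H" using * E' unfolding H_def by blast
  next
    fix b assume "b \<in> H"
    then obtain m n where *: "b \<in> E" "(b + mul m x) - mul n x \<in> ?A"
      unfolding H_def by blast
    have "- (b + mul m x) - (- mul n x) \<in> ?A"
      using cong_minus[OF A mul_E[OF X(2)] *(2)] .
    then have "cj (mul m x) (- (b + mul m x) - (- mul n x)) \<in> ?A"
      by (rule cj_E_mem[OF A mul_E[OF X(2)]])
    then have "(- b + mul n x) - mul m x \<in> ?A"
      by (simp add: cj_def group_norm del: add_uminus_conv_diff)
    then show "- b \<in> H" using * E' unfolding H_def by blast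
  qed
  moreover have "insert x X \<union> S \<subseteq> H"
  proof
    fix y assume y: "y \<in> insert x X \<union> S"
    then have yE: "y \<in> E" using X SE by auto
    have "(y + mul 0 x) - mul (if y \<in> X \<union> S then 0 else 1) x \<in> ?A"
      using y by (auto intro: op_hull.base op_hull.zero)
    then show "y \<in> H" using yE unfolding H_def by blast
  qed
  ultimately have "b \<in> H" using b gen_least by blast
  then obtain m n where *: "b \<in> E" "(b + mul m x) - mul n x \<in> ?A" unfolding H_def by blast
  show ?thesis
  proof (cases "m \<le> n")
    case True
    define k where "k = n - m"
    have k: "n = k + m" using True by (simp add: k_def)
    have "b - mul k x \<in> ?A"
      using *(2) by (simp add: k mul_add group_norm del: add_uminus_conv_diff)
    then show ?thesis by blast
  next
    case False
    define k where "k = m - n"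
    have k: "m = k + n" using False by (simp add: k_def)
    have "b + mul k x \<in> ?A"
      using *(2) by (simp add: k mul_add group_norm del: add_uminus_conv_diff)
    then have "- mul k x + - b \<in> ?A" using A' by (metis add_subgroupD(3) minus_add)
    then have "- b - mul k x \<in> ?A"
      using swap[OF A, of "- mul k x" "- b"] E' mul_E[OF X(2)] by simp
    then show ?thesis by blast
  qed
qed

text \<open>Induction on the generators of an abelian group: the image of \<open>U\<close> in the
  cyclic quotient spanned by \<open>x\<close> is generated by a single element, and the kernel
  \<open>U \<inter> ?A\<close> falls under the induction hypothesis.\<close>

lemma finitely_generated_subgroup:
  assumes "finite X" "X \<subseteq> E" "op_sub S E {} U" "U \<subseteq> gen (X \<union> S)"
  shows "\<exists>X'. finite X' \<and> X' \<subseteq> U \<and> U \<subseteq> gen (X' \<union> S)"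
  using assms
proof (induction X arbitrary: U)
  case empty
  then show ?case by (intro exI[of _ "{}"]) auto
next
  case (insert x X)
  let ?A = "gen (X \<union> S)"
  have X: "X \<subseteq> E" "x \<in> E" using insert.prems by auto
  have A: "op_sub S E {} ?A" by (rule op_sub_hull[OF X(1)])
  note U = insert.prems(2)
  note U' = U[unfolded op_sub_def] and A' = A[unfolded op_sub_def]
  have dich: "\<exists>n. u - mul n x \<in> ?A \<or> - u - mul n x \<in> ?A" if "u \<in> U" for u
    using gen_insert_multiple[OF X] that insert.prems(3) by auto
  show ?case
  proof (cases "\<exists>n. n > 0 \<and> (\<exists>u\<in>U. u - mul n x \<in> ?A)")
    case False
    have "U \<subseteq> ?A"
    proof
      fix u assume u: "u \<in> U"
      then have mu: "- u \<in> U" using U' by (auto dest: add_subgroupD(3))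
      obtain n where n: "u - mul n x \<in> ?A \<or> - u - mul n x \<in> ?A" using dich[OF u] by blast
      have "n = 0"
      proof (rule ccontr)
        assume "n \<noteq> 0"
        then have "n > 0" by simp
        with n u mu have "\<exists>n. n > 0 \<and> (\<exists>u\<in>U. u - mul n x \<in> ?A)" by meson
        then show False using False by simp
      qed
      then have "u \<in> ?A \<or> - u \<in> ?A" using n by simp
      then show "u \<in> ?A" using op_hull.minus[of "- u"] by auto
    qed
    then show ?thesis using insert.IH[OF X(1) U] by blast
  next
    case True
    \<comment> \<open>The least positive multiple of \<open>x\<close> in the image of
      \<open>U\<close>; repeated subtraction of the corresponding \<open>u0\<close> is Euclidean
      division by \<open>k\<close>.\<close>
    define k where "k = (LEAST n. n > 0 \<and> (\<exists>u\<in>U. u - mul n x \<in> ?A))"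
    have k: "k > 0" "\<exists>u\<in>U. u - mul k x \<in> ?A"
      using LeastI_ex[OF True] by (auto simp: k_def)
    have kmin: "k \<le> n" if "n > 0" "u \<in> U" "u - mul n x \<in> ?A" for n u
      unfolding k_def using that by (intro Least_le) auto
    obtain u0 where u0: "u0 \<in> U" "u0 - mul k x \<in> ?A" using k by blast
    have "op_sub S E {} (U \<inter> ?A)"
      using U' A' by (auto simp: op_sub_def add_subgroup_def conj_closed_def)
    then obtain X' where X': "finite X'" "X' \<subseteq> U \<inter> ?A" "U \<inter> ?A \<subseteq> gen (X' \<union> S)"
      using insert.IH[OF X(1), of "U \<inter> ?A"] by auto
    let ?G = "gen (insert u0 X' \<union> S)"
    have GA: "U \<inter> ?A \<subseteq> ?G"
      using X'(3) hull_mono[of "{}" "{}" "X' \<union> S" "insert u0 X' \<union> S"] by auto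
    have red: "u \<in> ?G" if "u \<in> U" "u - mul n x \<in> ?A" for n u
      using that
    proof (induction n arbitrary: u rule: less_induct)
      case (less n)
      show ?case
      proof (cases "n = 0")
        case True
        then show ?thesis using less.prems GA by auto
      next
        case False
        then have kn: "k \<le> n" using kmin less.prems by auto
        have uE: "u \<in> E" using less.prems U' by auto
        have "- u0 - - mul k x \<in> ?A" by (rule cong_minus[OF A mul_E[OF X(2)] u0(2)])
        then have "(u + - u0) - (mul n x + - mul k x) \<in> ?A"
          using cong_add[OF A uE less.prems(2)] by blast
        moreover have "mul n x + - mul k x = mul (n - k) x"
          using mul_add[of "n - k" k x] kn by simp
        ultimately have "(u - u0) - mul (n - k) x \<in> ?A" by simp
        moreover have "u - u0 \<in> U" using less.prems u0 U' by (auto dest: add_subgroupD(4))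
        ultimately have "u - u0 \<in> ?G" using less.IH[of "n - k"] kn k(1) by simp
        moreover have "u0 \<in> ?G" by (auto intro: op_hull.base)
        ultimately show ?thesis using op_hull.add[of "u - u0" "{}" _ u0] by simp
      qed
    qed
    have "U \<subseteq> ?G"
    proof
      fix u assume u: "u \<in> U"
      then have mu: "- u \<in> U" using U' by (auto dest: add_subgroupD(3))
      have "u \<in> ?G \<or> - u \<in> ?G" using dich[OF u] red u mu by blast
      then show "u \<in> ?G" using op_hull.minus[of "- u"] by auto
    qed
    then show ?thesis using X' u0 by (intro exI[of _ "insert u0 X'"]) auto
  qed
qed

text \<open>Under a trivial action the submodules are the subgroups between \<open>S\<close> and
  \<open>E\<close>; Hall's induction starts here.\<close>

lemma noetherian_trivial:
  assumes P: "\<And>p x. p \<in> P \<Longrightarrow> x \<in> E \<Longrightarrow> comm p x \<in> S"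
  shows "noetherian S E P"
  unfolding noetherian_def
proof (intro allI impI)
  fix X U assume X: "finite X" "X \<subseteq> E" and U: "op_sub S E P U" and UX: "U \<subseteq> op_hull P (X \<union> S)"
  have "op_sub S E P (gen (X \<union> S))" by (rule op_sub_trivial[OF P op_sub_hull[OF X(2)]])
  then have "op_hull P (X \<union> S) \<subseteq> gen (X \<union> S)"
    by (intro hull_S_least) (auto intro: op_hull.base)
  then obtain X' where X': "finite X'" "X' \<subseteq> U" "U \<subseteq> gen (X' \<union> S)"
    using finitely_generated_subgroup[OF X, of U] op_sub_empty[OF U] UX by auto
  moreover have "gen (X' \<union> S) \<subseteq> op_hull P (X' \<union> S)" by (rule hull_mono) auto
  ultimately show "\<exists>X'. finite X' \<and> X' \<subseteq> U \<and> U \<subseteq> op_hull P (X' \<union> S)" by (meson order_trans)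
qed

end

section \<open>Finite normal generation of intersections\<close>

text \<open>Only conjugation of \<open>A\<close> by \<open>Y\<close> and its negatives has to be
  tested: \<open>Z\<close> is normal and lies in \<open>D\<close>, so it moves \<open>A\<close> only
  by elements of \<open>D\<close>.\<close>

lemma gen_plus_normal:
  assumes D: "normal_sub D" and Z: "normal_sub Z" "Z \<subseteq> D" and Y: "gen (Y \<union> Z) = UNIV"
    and A: "\<And>y a. y \<in> Y \<Longrightarrow> a \<in> A \<Longrightarrow> cj y a \<in> gen A + D \<and> cj (- y) a \<in> gen A + D"
  shows "normal_sub (gen A + D)"
proof -
  let ?H = "gen A + D"
  have sD: "add_subgroup D" using D normal_subD by blast
  have H: "add_subgroup ?H" by (intro add_subgroup_plus add_subgroup_hull normal_subD[OF D])
  have DH: "D \<subseteq> ?H" by (rule subset_plus_right[OF add_subgroup_hull])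
  have AH: "gen A \<subseteq> ?H" by (rule subset_plus_left[OF sD])
  have *: "cj g u \<in> ?H" if g: "\<And>a. a \<in> A \<Longrightarrow> cj g a \<in> ?H" and u: "u \<in> ?H" for g u
  proof -
    have "add_subgroup {a. cj g a \<in> ?H}"
      using add_subgroupD[OF H] by (intro add_subgroupI) (auto simp: cj_add cj_minus)
    then have "gen A \<subseteq> {a. cj g a \<in> ?H}" by (rule gen_least) (use g in auto)
    moreover obtain a d where "a \<in> gen A" "d \<in> D" "u = a + d" using u by (meson set_plus_elim)
    moreover from this have "cj g d \<in> ?H" using normal_subD(3)[OF D] DH by blast
    ultimately show ?thesis using add_subgroupD(2)[OF H] by (auto simp: cj_add)
  qed
  have Zc: "cj z a \<in> ?H" if "z \<in> Z" "a \<in> A" for z a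
  proof -
    have "comm z a \<in> ?H" using normal_sub_comm[OF Z(1), of z a] that Z(2) DH by blast
    moreover have "a \<in> ?H" using that AH op_hull.base[of a A "{}"] by blast
    ultimately show ?thesis using add_subgroupD(2)[OF H] by (auto simp: cj_eq_comm)
  qed
  have "conj_closed (gen (Y \<union> Z)) ?H"
  proof (rule gen_normalizes[OF H])
    fix g u assume g: "g \<in> Y \<union> Z" and u: "u \<in> ?H"
    have "- z \<in> Z" if "z \<in> Z" for z using that Z(1) normal_subD(1) add_subgroupD(3) by blast
    then have "cj g a \<in> ?H" "cj (- g) a \<in> ?H" if "a \<in> A" for a
      using A that Zc g by blast+
    then show "cj g u \<in> ?H \<and> cj (- g) u \<in> ?H" using * u by blast
  qed
  then show ?thesis using H Y by (simp add: normal_sub_def)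
qed

text \<open>Generation is measured relative to \<open>Z\<close>, later the kernel of the projection
  of a free group on countably many generators to the first \<open>4 * k\<close> of them.\<close>

definition fin_normally_generated :: "'g::group_add set \<Rightarrow> 'g set \<Rightarrow> bool" where
  "fin_normally_generated Z N \<longleftrightarrow> (\<exists>T. finite T \<and> N = ncl (T \<union> Z))"

text \<open>Every normal subgroup of the quotient by \<open>L\<close> is projective; this holds for free quotients,
  subgroups of free groups being free.\<close>

definition projective_mod :: "'g::group_add set \<Rightarrow> bool" where
  "projective_mod L \<longleftrightarrow> (\<forall>E. normal_sub E \<longrightarrow> (\<exists>s. (\<forall>x\<in>E. s x \<in> E \<and> x - s x \<in> L) \<and>
     (\<forall>x\<in>E. \<forall>y\<in>E. s (x + y) = s x + s y) \<and> (\<forall>x\<in>E \<inter> L. s x = 0)))"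

definition commutators :: "'g::group_add set \<Rightarrow> 'g set" where
  "commutators E = gen {comm x y |x y. x \<in> E \<and> y \<in> E}"

lemma normal_sub_commutators:
  assumes "normal_sub E" shows "normal_sub (commutators E)"
  unfolding commutators_def
  by (rule normal_sub_gen) (use normal_subD(3)[OF assms] in \<open>fastforce simp: conj_closed_def cj_comm\<close>)

lemma commutators_subset:
  assumes "normal_sub E" shows "commutators E \<subseteq> E"
  unfolding commutators_def
  by (rule gen_least) (use normal_sub_comm[OF assms] normal_subD(1)[OF assms] in auto)

text \<open>The projection \<open>s\<close> of \<open>E\<close> that kills
  \<open>E \<inter> L\<close> satisfies \<open>c - s c \<in> D\<close> on commutators, because
  \<open>x\<close> and \<open>s x\<close> differ by an element of \<open>E \<inter> L\<close>, which
  is central in \<open>E\<close> modulo \<open>D\<close>. If \<open>c\<close> lies in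
  \<open>L\<close>, then \<open>s c = 0\<close>.\<close>

lemma commutators_Int_subset:
  assumes E: "normal_sub E" and L: "normal_sub L" "projective_mod L" and D: "normal_sub D"
    and c: "\<And>x y. x \<in> E \<inter> L \<Longrightarrow> y \<in> E \<Longrightarrow> comm x y \<in> D"
  shows "commutators E \<inter> L \<subseteq> D"
proof -
  note E' = add_subgroupD[OF normal_subD(1)[OF E]] and D' = add_subgroupD[OF normal_subD(1)[OF D]]
  obtain s where s: "\<And>x. x \<in> E \<Longrightarrow> s x \<in> E" "\<And>x. x \<in> E \<Longrightarrow> x - s x \<in> L"
      "\<And>x y. x \<in> E \<Longrightarrow> y \<in> E \<Longrightarrow> s (x + y) = s x + s y" "\<And>x. x \<in> E \<Longrightarrow> x \<in> L \<Longrightarrow> s x = 0"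
    using L(2) E unfolding projective_mod_def by (metis IntI)
  have s0: "s 0 = 0" using s(4) E' add_subgroupD(1)[OF normal_subD(1)[OF L(1)]] by blast
  have sm: "s (- x) = - s x" if "x \<in> E" for x
    using s(3)[of x "- x"] that E' s0 minus_unique[of "s x" "s (- x)"] by simp
  define H where "H = {c \<in> E. c - s c \<in> D}"
  have "add_subgroup H"
  proof (rule add_subgroupI)
    show "0 \<in> H" using E' D' by (simp add: H_def s0)
  next
    fix x y assume "x \<in> H" "y \<in> H"
    then have *: "x \<in> E" "y \<in> E" "x - s x \<in> D" "y - s y \<in> D" by (auto simp: H_def)
    have "x + y - s (x + y) = cj x (y - s y) + (x - s x)"
      using * s(3) by (simp add: cj_def group_norm del: add_uminus_conv_diff)
    then show "x + y \<in> H" using * E' D' normal_subD(3)[OF D] by (simp add: H_def)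
  next
    fix x assume "x \<in> H"
    then have *: "x \<in> E" "x - s x \<in> D" by (auto simp: H_def)
    have "- x - s (- x) = cj (- x) (- (x - s x))"
      using sm[OF *(1)] by (simp add: cj_def group_norm del: add_uminus_conv_diff)
    also have "\<dots> \<in> D" by (rule normal_subD(3)[OF D D'(3)[OF *(2)]])
    finally show "- x \<in> H" using * E' by (simp add: H_def)
  qed
  moreover have "{comm x y |x y. x \<in> E \<and> y \<in> E} \<subseteq> H"
  proof
    fix z assume "z \<in> {comm x y |x y. x \<in> E \<and> y \<in> E}"
    then obtain x y where xy: "x \<in> E" "y \<in> E" and z: "z = comm x y" by auto
    have sz: "s z = comm (s x) (s y)"
      using xy s(3) sm E' unfolding z comm_def diff_conv_add_uminus
      by (simp del: add_uminus_conv_diff)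
    define a b p q where "a = x - s x" and "b = y - s y" and "p = s x" and "q = s y"
    have x: "x = a + p" and y: "y = b + q" by (simp_all add: a_def b_def p_def q_def)
    have ab: "a \<in> E \<inter> L" "b \<in> E \<inter> L" "p \<in> E" "q \<in> E"
      using xy s E' by (auto simp: a_def b_def p_def q_def)
    have zE: "comm v w \<in> E" if "v \<in> E" for v w using normal_sub_comm[OF E] that by blast
    have 1: "comm b (comm p q) \<in> D" "comm a (comm p y) \<in> D" "comm a y \<in> D"
      using c ab xy zE by blast+
    have 2: "comm p b \<in> D" using comm_swap_mem[OF D c[of b p]] ab by blast
    have szpq: "s z = comm p q" by (simp add: sz p_def q_def)
    \<comment> \<open>Each term on the right involves \<open>a\<close> or \<open>b\<close>, and
      hence lies in \<open>D\<close>.\<close>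
    have "comm (a + p) (b + q) - comm p q = comm a (comm p (b + q)) +
        (comm p b + (comm b (comm p q) + cj (comm p q) (comm a (b + q))))"
      by (simp add: cj_def comm_def group_norm del: add_uminus_conv_diff)
    then have "z - s z = comm a (comm p y) + (comm p b + (comm b (comm p q) + cj (comm p q) (comm a y)))"
      unfolding x[symmetric] y[symmetric] z[symmetric] szpq[symmetric] .
    then have "z - s z \<in> D" using 1 2 D' normal_subD(3)[OF D] by simp
    then show "z \<in> H" using zE xy by (simp add: H_def z)
  qed
  ultimately have "commutators E \<subseteq> H" unfolding commutators_def by (rule gen_least)
  then show ?thesis using s(4) by (auto simp: H_def)
qed

section \<open>Intersecting with one more kernel\<close>

locale finitely_generated_mod =
  fixes Y Z :: "'g::group_add set"
  assumes Z: "normal_sub Z" and Y: "finite Y" "gen (Y \<union> Z) = UNIV"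
begin

lemma sym_gens: "\<exists>Y'. finite Y' \<and> Y \<subseteq> Y' \<and> (\<forall>y\<in>Y'. - y \<in> Y')"
  by (rule exI[of _ "Y \<union> uminus ` Y"]) (use Y in auto)

lemma gen_plus_normal':
  assumes "normal_sub D" "Z \<subseteq> D" "Y \<subseteq> Y'" "\<And>y. y \<in> Y' \<Longrightarrow> - y \<in> Y'"
    and "\<And>y a. y \<in> Y' \<Longrightarrow> a \<in> A \<Longrightarrow> cj y a \<in> gen A + D"
  shows "normal_sub (gen A + D)"
proof -
  have "gen (Y \<union> Z) \<subseteq> gen (Y' \<union> Z)" by (rule hull_mono) (use assms(3) in auto)
  then have Y': "gen (Y' \<union> Z) = UNIV" using Y by auto
  show ?thesis by (rule gen_plus_normal[OF assms(1) Z assms(2) Y']) (use assms(4,5) in auto)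
qed

text \<open>The section to which noetherianness applies is built from \<open>D\<close> inside the
  proof; hence \<open>N\<close> asks for it on all abelian sections of \<open>E\<close> with trivial
  action of \<open>L\<close>.\<close>

lemma fin_normally_generated_Int:
  assumes E: "normal_sub E" "fin_normally_generated Z E" and L: "normal_sub L" "fin_normally_generated Z L" "projective_mod L"
    and ZEL: "Z \<subseteq> E" "Z \<subseteq> L"
    and A: "finite A" "A \<subseteq> L" "L \<subseteq> gen A + E"
    and N: "\<And>S. abelian_section E S \<Longrightarrow> (\<And>x l. x \<in> E \<Longrightarrow> l \<in> L \<Longrightarrow> comm l x \<in> S) \<Longrightarrow> noetherian S E UNIV"
  shows "fin_normally_generated Z (E \<inter> L)"
proof -
  obtain R where R: "finite R" "E = ncl (R \<union> Z)" using E unfolding fin_normally_generated_def by blast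
  obtain \<Lambda> where \<Lambda>: "finite \<Lambda>" "L = ncl (\<Lambda> \<union> Z)" using L unfolding fin_normally_generated_def by blast
  obtain Y' where Y': "finite Y'" "Y \<subseteq> Y'" "\<And>y. y \<in> Y' \<Longrightarrow> - y \<in> Y'" using sym_gens by blast
  note L' = add_subgroupD[OF normal_subD(1)[OF L(1)]]
  have RE: "R \<subseteq> E" "\<Lambda> \<subseteq> L" unfolding R(2) \<Lambda>(2) by (auto intro: op_hull.base)
  have gA: "gen A \<subseteq> L" by (rule gen_least[OF normal_subD(1)[OF L(1)] A(2)])
  \<comment> \<open>Each \<open>l\<close> in \<open>L\<close> agrees modulo \<open>E\<close> with an
    element \<open>w l\<close> of \<open>gen A\<close>; the discrepancy, called
    \<open>corr l\<close> below, lies in \<open>E \<inter> L\<close>.\<close>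
  have "\<forall>l\<in>L. \<exists>w. w \<in> gen A \<and> - w + l \<in> E"
  proof
    fix l assume "l \<in> L"
    then obtain w e where "w \<in> gen A" "e \<in> E" "l = w + e" using A(3) by (meson set_plus_elim subsetD)
    then show "\<exists>w. w \<in> gen A \<and> - w + l \<in> E" by (intro exI[of _ w]) simp
  qed
  then obtain w where w: "\<And>l. l \<in> L \<Longrightarrow> w l \<in> gen A" "\<And>l. l \<in> L \<Longrightarrow> - w l + l \<in> E" by metis
  define corr where "corr l = - w l + l" for l
  \<comment> \<open>These elements serve three purposes: \<open>gen A + D\<close> becomes normal, it
    contains the normal generators of \<open>L\<close>, and \<open>R\<close> commutes with
    \<open>A\<close> modulo \<open>D\<close>.\<close>
  define T1 where "T1 = corr ` ((\<lambda>(y, a). cj y a) ` (Y' \<times> A) \<union> \<Lambda>) \<union> (\<lambda>(e, a). comm e a) ` (R \<times> A)"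
  have corr: "corr l \<in> E \<inter> L" if "l \<in> L" for l
    using w[OF that] gA L' that by (auto simp: corr_def)
  have T1: "finite T1" unfolding T1_def using Y' A R \<Lambda> by blast
  have T1EL: "T1 \<subseteq> E \<inter> L"
    using corr RE A(2) normal_subD(3)[OF L(1)] normal_sub_comm[OF E(1)] normal_sub_comm[OF L(1)]
    unfolding T1_def by (auto simp: subset_iff)
  define D where "D = ncl (T1 \<union> Z)"
  have D: "normal_sub D" unfolding D_def by (rule normal_sub_ncl)
  note D' = add_subgroupD[OF normal_subD(1)[OF D]]
  have ZD: "Z \<subseteq> D" and T1D: "T1 \<subseteq> D" unfolding D_def by (auto intro: op_hull.base)
  have DEL: "D \<subseteq> E \<inter> L"
    unfolding D_def using T1EL ZEL by (intro ncl_least normal_sub_Int E L) auto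
  have l_mem: "l \<in> gen A + D" if "corr l \<in> D" "l \<in> L" for l
  proof -
    have "l = w l + corr l" by (simp add: corr_def)
    then show ?thesis using w that by (metis set_plus_intro)
  qed
  have nAD: "normal_sub (gen A + D)"
  proof (rule gen_plus_normal'[OF D ZD Y'(2,3)])
    fix y a assume ya: "y \<in> Y'" "a \<in> A"
    then have "corr (cj y a) \<in> T1" unfolding T1_def by auto
    then show "cj y a \<in> gen A + D"
      using l_mem T1D normal_subD(3)[OF L(1)] ya A(2) by blast
  qed
  have "\<Lambda> \<subseteq> gen A + D"
  proof
    fix l assume l: "l \<in> \<Lambda>"
    then have "corr l \<in> T1" unfolding T1_def by auto
    then show "l \<in> gen A + D" using l_mem T1D RE l by blast
  qed
  moreover have "Z \<subseteq> gen A + D" using ZD subset_plus_right[OF add_subgroup_hull, of D] by blast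
  ultimately have "L \<subseteq> gen A + D" unfolding \<Lambda>(2) by (intro ncl_least nAD) auto
  also have "\<dots> \<subseteq> gen (A \<union> D)"
    by (intro plus_least add_subgroup_hull hull_mono) (auto intro: op_hull.base)
  finally have LAD: "L \<subseteq> gen (A \<union> D)" .
  \<comment> \<open>Commutators are tested on generators: \<open>E\<close> is the normal closure of
    \<open>R\<close> and \<open>Z\<close>, and \<open>L\<close> lies in the subgroup generated by
    \<open>A\<close> and \<open>D\<close>.\<close>
  have EL: "comm x l \<in> D" if "x \<in> E" "l \<in> L" for x l
  proof (rule comm_ncl_mem[OF D normal_subD(2)[OF L(1)] _ _ that(2)])
    show "x \<in> ncl (R \<union> Z)" using that R by simp
  next
    fix e l assume e: "e \<in> R \<union> Z" and l: "l \<in> L"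
    show "comm e l \<in> D"
    proof (cases "e \<in> Z")
      case True
      then show ?thesis using normal_sub_comm[OF D] ZD by blast
    next
      case False
      then have eR: "e \<in> R" using e by blast
      have "comm l e \<in> D"
      proof (rule comm_gen_mem[OF D, of "A \<union> D" "{e}"])
        fix t g assume t: "t \<in> A \<union> D" and g: "g \<in> {e}"
        have "comm e t \<in> T1" if "t \<in> A" unfolding T1_def using that eR by auto
        then show "comm t g \<in> D"
          using t g T1D comm_swap_mem[OF D, of e t] normal_sub_comm[OF D, of t e] by blast
      qed (use l LAD in auto)
      then show ?thesis by (rule comm_swap_mem[OF D])
    qed
  qed
  \<comment> \<open>\<open>E\<close> modulo \<open>S\<close> is the abelianization of
    \<open>E\<close> modulo \<open>D\<close>; by \<open>EL\<close>, \<open>L\<close> acts trivially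
    on it.\<close>
  define S where "S = commutators E + D"
  have nS: "normal_sub S" unfolding S_def by (intro normal_sub_plus normal_sub_commutators E D)
  have CS: "commutators E \<subseteq> S" "D \<subseteq> S"
    unfolding S_def
    using subset_plus_left[OF normal_subD(1)[OF D]]
      subset_plus_right[OF normal_subD(1)[OF normal_sub_commutators[OF E(1)]]] by blast+
  have SE: "S \<subseteq> E"
    unfolding S_def using commutators_subset[OF E(1)] DEL normal_subD(1)[OF E(1)]
    by (intro plus_least) auto
  interpret abelian_section E S
  proof
    fix x y assume "x \<in> E" "y \<in> E"
    then have "comm x y \<in> commutators E" unfolding commutators_def by (auto intro!: op_hull.base)
    then show "comm x y \<in> S" using CS by blast
  qed (use E nS SE in auto)
  have noe: "noetherian S E UNIV"
    using N[OF abelian_section_axioms] EL comm_swap_mem[OF D] CS by blast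
  \<comment> \<open>The preimage of the image of \<open>E \<inter> L\<close> in this module. It is
    finitely generated modulo \<open>S\<close>, and its generators are then adjusted by
    \<open>S\<close> to lie in \<open>E \<inter> L\<close>.\<close>
  define U where "U = (E \<inter> L) + S"
  have nEL: "normal_sub (E \<inter> L)" by (intro normal_sub_Int E L)
  have nU: "normal_sub U" unfolding U_def by (intro normal_sub_plus nEL nS)
  have ELU: "E \<inter> L \<subseteq> U" "S \<subseteq> U"
    unfolding U_def using subset_plus_left[OF normal_subD(1)[OF nS]]
      subset_plus_right[OF normal_subD(1)[OF nEL]] by blast+
  have UE: "U \<subseteq> E" unfolding U_def using SE normal_subD(1)[OF E(1)] by (intro plus_least) auto
  have opU: "op_sub S E UNIV U" using nU ELU UE by (auto simp: op_sub_def normal_sub_def)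
  have UR: "U \<subseteq> ncl (R \<union> S)"
  proof -
    have "ncl (R \<union> Z) \<subseteq> ncl (R \<union> S)" using ZD CS by (intro hull_mono) auto
    then show ?thesis using UE R(2) by blast
  qed
  from noe[unfolded noetherian_def, rule_format, OF R(1) RE(1) opU UR]
  obtain X where X: "finite X" "X \<subseteq> U" "U \<subseteq> ncl (X \<union> S)" by (elim exE conjE)
  have "\<forall>x\<in>X. \<exists>v. v \<in> E \<inter> L \<and> - v + x \<in> S"
  proof
    fix x assume "x \<in> X"
    then obtain v z where "v \<in> E \<inter> L" "z \<in> S" "x = v + z"
      using X(2) unfolding U_def by (meson set_plus_elim subsetD)
    then show "\<exists>v. v \<in> E \<inter> L \<and> - v + x \<in> S" by (intro exI[of _ v]) simp
  qed
  then obtain f where f: "\<And>x. x \<in> X \<Longrightarrow> f x \<in> E \<inter> L" "\<And>x. x \<in> X \<Longrightarrow> - f x + x \<in> S" by metis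
  define T2 where "T2 = f ` X"
  define F where "F = ncl (T1 \<union> T2 \<union> Z)"
  have F: "normal_sub F" unfolding F_def by (rule normal_sub_ncl)
  note F' = add_subgroupD[OF normal_subD(1)[OF F]]
  have FEL: "F \<subseteq> E \<inter> L"
    unfolding F_def using T1EL f(1) ZEL by (intro ncl_least nEL) (auto simp: T2_def)
  have DF: "D \<subseteq> F" unfolding D_def F_def by (intro hull_mono) auto
  have "X \<subseteq> F + S"
  proof
    fix x assume x: "x \<in> X"
    have "f x \<in> F" unfolding F_def T2_def using x by (auto intro: op_hull.base)
    then have "f x + (- f x + x) \<in> F + S" using f(2)[OF x] by (rule set_plus_intro)
    then show "x \<in> F + S" by simp
  qed
  moreover have "S \<subseteq> F + S" by (rule subset_plus_right[OF normal_subD(1)[OF F]])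
  ultimately have UF: "U \<subseteq> F + S"
    using X(3) ncl_least[OF normal_sub_plus[OF F nS], of "X \<union> S"] by blast
  \<comment> \<open>Agreement modulo \<open>S\<close> suffices: the error \<open>c + d\<close> has
    its commutator part \<open>c\<close> in \<open>L\<close>, hence in \<open>D\<close> by the
    splitting.\<close>
  have "E \<inter> L \<subseteq> F"
  proof
    fix x assume x: "x \<in> E \<inter> L"
    then obtain t z where tz: "t \<in> F" "z \<in> S" "x = t + z" using ELU UF by (meson set_plus_elim subsetD)
    then obtain c d where cd: "c \<in> commutators E" "d \<in> D" "z = c + d"
      unfolding S_def by (meson set_plus_elim)
    have "- t + x \<in> L" using tz(1) FEL x L' by blast
    then have "z \<in> L" using tz(3) by simp
    then have "z - d \<in> L" using cd(2) DEL L'(4) by blast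
    then have "c \<in> L" using cd(3) by simp
    moreover have "commutators E \<inter> L \<subseteq> D"
      by (rule commutators_Int_subset[OF E(1) L(1,3) D]) (use EL comm_swap_mem[OF D] in auto)
    ultimately have "c \<in> D" using cd(1) by blast
    then have "c + d \<in> F" using cd(2) DF F'(2) by blast
    then show "x \<in> F" using tz(1,3) cd(3) F'(2) by simp
  qed
  then have "E \<inter> L = ncl ((T1 \<union> T2) \<union> Z)" using FEL by (auto simp: F_def)
  moreover have "finite (T1 \<union> T2)" using T1 X(1) by (simp add: T2_def)
  ultimately show ?thesis unfolding fin_normally_generated_def by blast
qed

end

section \<open>Intersections of a pairwise comaximal family\<close>

locale comaximal_family = finitely_generated_mod Y Z for Y Z :: "'g::group_add set" +
  fixes L :: "nat \<Rightarrow> 'g set" and m :: nat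
  assumes nL: "\<And>i. i < m \<Longrightarrow> normal_sub (L i)" and ZL: "\<And>i. i < m \<Longrightarrow> Z \<subseteq> L i"
    and fL: "\<And>i. i < m \<Longrightarrow> fin_normally_generated Z (L i)" and pL: "\<And>i. i < m \<Longrightarrow> projective_mod (L i)"
    and comax: "\<And>i j. i < m \<Longrightarrow> j < m \<Longrightarrow> i \<noteq> j \<Longrightarrow> L i + L j = UNIV"
begin

definition isect :: "nat \<Rightarrow> 'g set" where "isect n = {g. \<forall>i<n. g \<in> L i}"

lemma isect_0: "isect 0 = UNIV" and isect_Suc: "isect (Suc n) = isect n \<inter> L n"
  by (auto simp: isect_def less_Suc_eq)

lemma normal_sub_isect: "n \<le> m \<Longrightarrow> normal_sub (isect n)"
proof (induction n)
  case 0
  then show ?case by (simp add: isect_0 normal_sub_def add_subgroup_def conj_closed_def)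
next
  case (Suc n)
  then show ?case using nL[of n] by (simp add: isect_Suc normal_sub_Int)
qed

lemma Z_isect: "n \<le> m \<Longrightarrow> Z \<subseteq> isect n"
  unfolding isect_def using ZL less_le_trans by blast

text \<open>By comaximality a generator \<open>y\<close> agrees modulo \<open>L n\<close> with an
  element \<open>u y\<close> of \<open>L j\<close>. On \<open>isect n\<close>, conjugation by
  \<open>y\<close> and by \<open>u y\<close> agree modulo \<open>isect (Suc n)\<close>, so finitely
  many elements of \<open>L j\<close> suffice to generate a normal subgroup modulo
  \<open>isect (Suc n)\<close>.\<close>

lemma fg_mod_isect:
  assumes j: "j < m" shows "n \<le> j \<Longrightarrow> \<exists>A. finite A \<and> A \<subseteq> L j \<and> L j \<subseteq> gen A + isect n"
proof (induction n)
  case 0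
  have "L j \<subseteq> gen {} + isect 0" using subset_plus_right[OF add_subgroup_hull, of UNIV] by (auto simp: isect_0)
  then show ?case by blast
next
  case (Suc n)
  then obtain A where A: "finite A" "A \<subseteq> L j" "L j \<subseteq> gen A + isect n" by auto
  have nm: "n < m" "n \<noteq> j" using Suc.prems j by auto
  let ?N = "L j"
  have N: "normal_sub ?N" using nL j by blast
  note N' = add_subgroupD[OF normal_subD(1)[OF N]]
  obtain \<Lambda> where \<Lambda>: "finite \<Lambda>" "?N = ncl (\<Lambda> \<union> Z)" using fL[OF j] unfolding fin_normally_generated_def by blast
  have \<Lambda>N: "\<Lambda> \<subseteq> ?N" unfolding \<Lambda>(2) by (auto intro: op_hull.base)
  obtain Y' where Y': "finite Y'" "Y \<subseteq> Y'" "\<And>y. y \<in> Y' \<Longrightarrow> - y \<in> Y'" using sym_gens by blast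
  have "\<forall>y. \<exists>u. u \<in> ?N \<and> - u + y \<in> L n"
  proof
    fix y :: 'g
    have "y \<in> ?N + L n" using comax[of j n] nm j by auto
    then obtain u l where "u \<in> ?N" "l \<in> L n" "y = u + l" by (meson set_plus_elim)
    then show "\<exists>u. u \<in> ?N \<and> - u + y \<in> L n" by (intro exI[of _ u]) simp
  qed
  then obtain u where u: "\<And>y. u y \<in> ?N" "\<And>y. - u y + y \<in> L n" by metis
  have gA: "gen A \<subseteq> ?N" by (rule gen_least[OF normal_subD(1)[OF N] A(2)])
  have "\<forall>l\<in>?N. \<exists>w. w \<in> gen A \<and> - w + l \<in> isect n"
  proof
    fix l assume "l \<in> ?N"
    then obtain w e where "w \<in> gen A" "e \<in> isect n" "l = w + e"
      using A(3) by (meson set_plus_elim subsetD)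
    then show "\<exists>w. w \<in> gen A \<and> - w + l \<in> isect n" by (intro exI[of _ w]) simp
  qed
  then obtain w where w: "\<And>l. l \<in> ?N \<Longrightarrow> w l \<in> gen A" "\<And>l. l \<in> ?N \<Longrightarrow> - w l + l \<in> isect n" by metis
  \<comment> \<open>\<open>A0\<close> adds to \<open>A\<close> the approximations \<open>u y\<close>
    and the normal generators of \<open>L j\<close>. The set \<open>Q\<close> below collects the
    errors made when conjugates of \<open>A0\<close> are rewritten in \<open>A\<close>; these lie in
    \<open>isect n\<close>.\<close>
  define A0 where "A0 = A \<union> u ` Y' \<union> \<Lambda>"
  define Q where "Q = (\<lambda>l. - w l + l) ` (\<lambda>(y, a). cj y a) ` (Y' \<times> A0)"
  define A1 where "A1 = A0 \<union> Q"
  have A0N: "A0 \<subseteq> ?N" using A u \<Lambda>N by (auto simp: A0_def)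
  have cjN: "cj y a \<in> ?N" if "a \<in> ?N" for y a using normal_subD(3)[OF N] that by blast
  have QN: "q \<in> ?N \<and> q \<in> isect n" if q: "q \<in> Q" for q
  proof -
    obtain y a where ya: "y \<in> Y'" "a \<in> A0" "q = - w (cj y a) + cj y a" using q by (auto simp: Q_def)
    have l: "cj y a \<in> ?N" using cjN ya A0N by blast
    then show ?thesis using w[OF l] gA N' ya by auto
  qed
  have fin: "finite A1" using A Y' \<Lambda> by (simp add: A1_def A0_def Q_def)
  have A1N: "A1 \<subseteq> ?N" using A0N QN by (auto simp: A1_def)
  let ?M = "isect (Suc n)"
  have M: "normal_sub ?M" "Z \<subseteq> ?M" using normal_sub_isect Z_isect Suc.prems j by auto
  have sH: "add_subgroup (gen A1 + ?M)"
    by (intro add_subgroup_plus add_subgroup_hull normal_subD[OF M(1)])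
  have AH: "gen A1 \<subseteq> gen A1 + ?M" by (rule subset_plus_left[OF normal_subD(1)[OF M(1)]])
  have MH: "?M \<subseteq> gen A1 + ?M" by (rule subset_plus_right[OF add_subgroup_hull])
  have A1g: "a \<in> gen A1" if "a \<in> A1" for a using that by (rule op_hull.base)
  have gA1: "gen A \<subseteq> gen A1" by (rule hull_mono) (auto simp: A1_def A0_def)
  have "normal_sub (gen A1 + ?M)"
  proof (rule gen_plus_normal'[OF M Y'(2,3)])
    fix y a assume y: "y \<in> Y'" and a: "a \<in> A1"
    show "cj y a \<in> gen A1 + ?M"
    proof (cases "a \<in> A0")
      case True
      define q where "q = - w (cj y a) + cj y a"
      have "q \<in> A1" unfolding q_def A1_def Q_def using y True by blast
      moreover have "w (cj y a) \<in> gen A1" using w(1) cjN A0N True gA1 by blast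
      ultimately have "w (cj y a) + q \<in> gen A1" using A1g by (intro op_hull.add) auto
      then have "cj y a \<in> gen A1" by (simp add: q_def)
      then show ?thesis using AH by blast
    next
      case False
      then have aM: "a \<in> isect n" using a QN by (auto simp: A1_def)
      \<comment> \<open>Since \<open>a\<close> lies in \<open>isect n\<close>, the part
        \<open>l\<close> of \<open>y\<close> in \<open>L n\<close> contributes only a commutator in
        \<open>isect (Suc n)\<close>.\<close>
      define l where "l = - u y + y"
      have yl: "y = u y + l" by (simp add: l_def)
      have l: "l \<in> L n" using u by (simp add: l_def)
      have "comm l a \<in> ?M"
        using normal_sub_comm[OF nL[OF nm(1)], of l a] normal_sub_comm[OF normal_sub_isect, of n l a] l aM nm
        by (simp add: isect_Suc)
      then have "cj (u y) (comm l a) \<in> gen A1 + ?M" using normal_subD(3)[OF M(1)] MH by blast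
      moreover have "u y \<in> gen A1" using y by (intro A1g) (auto simp: A1_def A0_def)
      then have "cj (u y) a \<in> gen A1"
        using A1g[OF a] unfolding cj_def by (metis add_subgroupD(2,4) add_subgroup_hull)
      ultimately have "cj (u y) (comm l a) + cj (u y) a \<in> gen A1 + ?M"
        using AH add_subgroupD(2)[OF sH] by blast
      moreover have "cj y a = cj (u y) (comm l a) + cj (u y) a"
        by (subst yl) (simp add: cj_cj cj_add[symmetric] cj_eq_comm[symmetric])
      ultimately show ?thesis by simp
    qed
  qed
  moreover have "\<Lambda> \<subseteq> gen A1 + ?M" using AH A1g by (auto simp: A1_def A0_def)
  moreover have "Z \<subseteq> gen A1 + ?M" using M MH by blast
  ultimately have "?N \<subseteq> gen A1 + ?M" unfolding \<Lambda>(2) by (intro ncl_least) auto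
  then show ?case using fin A1N by blast
qed

text \<open>Descending induction on \<open>k\<close> for the operator group
  \<open>isect k + L n\<close>, from a trivial action at \<open>k = n\<close> to the whole group at
  \<open>k = 0\<close>. Each stage is a finitely generated central extension of the previous
  one.\<close>

lemma noetherian_isect:
  assumes n: "n < m" and S: "abelian_section (isect n) S"
    and comm_S: "\<And>x l. x \<in> isect n \<Longrightarrow> l \<in> L n \<Longrightarrow> comm l x \<in> S"
    and fM: "\<And>k. k \<le> n \<Longrightarrow> fin_normally_generated Z (isect k)"
  shows "noetherian S (isect n) UNIV"
proof -
  interpret S: abelian_section "isect n" S by (rule S)
  have nP: "normal_sub (isect k + L n)" if "k \<le> n" for k
    using that n by (intro normal_sub_plus normal_sub_isect nL) auto
  have "noetherian S (isect n) (isect k + L n)" if "k \<le> n" for k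
    using that
  proof (induction k rule: inc_induct)
    case base
    show ?case
    proof (rule S.noetherian_trivial)
      fix p x assume "p \<in> isect n + L n" and x: "x \<in> isect n"
      then obtain e l where el: "e \<in> isect n" "l \<in> L n" "p = e + l" by (meson set_plus_elim)
      have "cj e (comm l x) \<in> S" "comm e x \<in> S"
        using comm_S[OF x el(2)] S.comm_S[OF el(1) x] S.nS normal_subD(3) by blast+
      then show "comm p x \<in> S"
        using S.nS el(3) by (auto simp: comm_add_left normal_sub_def dest: add_subgroupD(2))
    qed
  next
    case (step k)
    let ?P = "isect (Suc k) + L n"
    have nP': "normal_sub ?P" using nP step by auto
    have kn: "k < m" "k \<noteq> n" using step n by auto
    have M: "normal_sub (isect k)" using normal_sub_isect kn by auto
    obtain R where R: "finite R" "isect k = ncl (R \<union> Z)" using fM step unfolding fin_normally_generated_def by (meson less_imp_le)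
    have RM: "R \<subseteq> isect k" unfolding R(2) by (auto intro: op_hull.base)
    have sub: "L n \<subseteq> ?P" "isect (Suc k) \<subseteq> ?P"
      using subset_plus_right[OF normal_subD(1)[OF normal_sub_isect[of "Suc k"]], of "L n"]
        subset_plus_left[OF normal_subD(1)[OF nL[OF n]], of "isect (Suc k)"] kn by auto
    \<comment> \<open>Split \<open>g\<close> by comaximality: the part in \<open>L k\<close> gives a
      commutator in \<open>isect (Suc k)\<close>, the part in \<open>L n\<close> one in
      \<open>L n\<close>.\<close>
    have central: "comm t g \<in> ?P" if "t \<in> isect k" for t g
    proof -
      have "g \<in> L k + L n" using comax[OF kn(1) n kn(2)] by simp
      then obtain a b where ab: "a \<in> L k" "b \<in> L n" "g = a + b" by (meson set_plus_elim)
      have "comm t a \<in> isect (Suc k)"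
        using normal_sub_comm[OF M, of t a] normal_sub_comm[OF nL[OF kn(1)], of t a] that ab
        by (simp add: isect_Suc)
      moreover have "cj a (comm t b) \<in> L n"
        using normal_sub_comm[OF nL[OF n], of t b] ab normal_subD(3)[OF nL[OF n]] by blast
      ultimately show ?thesis using ab(3) by (simp add: comm_add_right set_plus_intro)
    qed
    have "noetherian S (isect n) (gen R + ?P)"
      using S.noetherian_central_extension[OF nP' step.IH R(1)] central RM by blast
    \<comment> \<open>Normal generators become ordinary generators because \<open>R\<close> is
      central modulo \<open>?P\<close>.\<close>
    moreover have "gen R + ?P = isect k + L n"
    proof
      have nH: "normal_sub (gen R + ?P)" using normal_sub_gen_plus[OF nP'] central RM by blast
      have PH: "?P \<subseteq> gen R + ?P" by (rule subset_plus_right[OF add_subgroup_hull])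
      have "R \<subseteq> gen R + ?P"
        using subset_plus_left[OF normal_subD(1)[OF nP'], of "gen R"] subset_hull[of R "{}"] by blast
      moreover have "Z \<subseteq> gen R + ?P" using ZL[OF n] sub PH by blast
      ultimately have "isect k \<subseteq> gen R + ?P" unfolding R(2) by (intro ncl_least nH) auto
      then show "isect k + L n \<subseteq> gen R + ?P"
        using sub PH by (intro plus_least normal_subD(1)[OF nH]) auto
      have sK: "isect k \<subseteq> isect k + L n" "L n \<subseteq> isect k + L n"
        using subset_plus_right[OF normal_subD(1)[OF M]] subset_plus_left[OF normal_subD(1)[OF nL[OF n]]] by blast+
      have nK: "add_subgroup (isect k + L n)" using nP[of k] step normal_subD by auto
      have "gen R \<subseteq> isect k + L n" using RM sK by (intro gen_least nK) auto
      moreover have "?P \<subseteq> isect k + L n" using sK by (intro plus_least nK) (auto simp: isect_Suc)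
      ultimately show "gen R + ?P \<subseteq> isect k + L n" by (rule plus_least[OF nK])
    qed
    ultimately show ?case by simp
  qed
  from this[of 0] have "noetherian S (isect n) (UNIV + L n)" by (simp add: isect_0)
  moreover have "UNIV + L n = UNIV" using subset_plus_left[OF normal_subD(1)[OF nL[OF n]], of UNIV] by auto
  ultimately show ?thesis by simp
qed

text \<open>Complete induction, since the noetherian property at stage \<open>k\<close> uses finite
  normal generation of all intersections up to \<open>k\<close>.\<close>

theorem fin_normally_generated_isect: "n \<le> m \<Longrightarrow> fin_normally_generated Z (isect n)"
proof (induction n rule: less_induct)
  case (less n)
  show ?case
  proof (cases n)
    case 0
    have "gen (Y \<union> Z) \<subseteq> ncl (Y \<union> Z)" by (rule hull_mono) auto
    then have "isect n = ncl (Y \<union> Z)" using Y(2) by (simp add: 0 isect_0 top_unique)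
    then show ?thesis using Y(1) unfolding fin_normally_generated_def by blast
  next
    case (Suc k)
    then have k: "k < m" using less.prems by simp
    obtain A where A: "finite A" "A \<subseteq> L k" "L k \<subseteq> gen A + isect k" using fg_mod_isect[OF k order_refl] by blast
    have "fin_normally_generated Z (isect k \<inter> L k)"
    proof (rule fin_normally_generated_Int[OF _ _ nL[OF k] fL[OF k] pL[OF k] _ ZL[OF k] A])
      fix S assume "abelian_section (isect k) S" "\<And>x l. x \<in> isect k \<Longrightarrow> l \<in> L k \<Longrightarrow> comm l x \<in> S"
      then show "noetherian S (isect k) UNIV" using less.IH k Suc by (intro noetherian_isect) auto
    qed (use less.IH[of k] k Suc normal_sub_isect Z_isect in auto)
    then show ?thesis by (simp add: Suc isect_Suc)
  qed
qed

end

section \<open>Free groups\<close>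

abbreviation reduced :: "'a letter list \<Rightarrow> bool" where
  "reduced \<equiv> successively (\<lambda>l l'. l' \<noteq> inv_letter l)"

lemma inv_letter_simps [simp]:
  "inv_letter (inv_letter l) = l" "inv_letter l \<noteq> l" "l \<noteq> inv_letter l"
  "inv_letter l = inv_letter l' \<longleftrightarrow> l = l'" "inv_letter (b, x) = (\<not> b, x)" "snd (inv_letter l) = snd l"
  by (auto simp: inv_letter_def prod_eq_iff)

lemma reduced_words_UNIV: "reduced_words UNIV = {w. reduced w}"
  by (simp add: reduced_words_def)

lemma reduced_push: "reduced w \<Longrightarrow> reduced (push_letter l w)"
  by (cases w) (auto simp: successively_Cons)

lemma reduced_foldr_push: "reduced w \<Longrightarrow> reduced (foldr push_letter u w)"
  by (induction u) (auto intro: reduced_push)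

lemma push_inv_push: "reduced w \<Longrightarrow> push_letter l (push_letter (inv_letter l) w) = w"
  by (cases w; cases "tl w") (auto split: if_splits)

lemma push_reduced: "reduced (l # w) \<Longrightarrow> push_letter l w = l # w"
  by (cases w) auto

text \<open>Free reduction is invisible to any family of maps in which inverse letters act inversely;
  this is the universal property of the free group.\<close>

lemma foldr_push:
  assumes f: "\<And>l s. s \<in> \<Omega> \<Longrightarrow> f l s \<in> \<Omega> \<and> f (inv_letter l) (f l s) = s" and s: "s \<in> \<Omega>"
  shows "foldr f (foldr push_letter u v) s = foldr f u (foldr f v s)"
proof -
  have \<Omega>: "foldr f w s \<in> \<Omega>" for w by (induction w) (use f s in auto)
  have "foldr f (push_letter l w) s = f l (foldr f w s)" for l w
    using f[OF \<Omega>, of l] f[OF \<Omega>, of "inv_letter l"] by (cases w) auto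
  then show ?thesis by (induction u) simp_all
qed

text \<open>Letters act on reduced words by pushing, with inverse letters acting inversely;
  associativity is the invariance of this action under free reduction.\<close>

lemma foldr_push_assoc:
  assumes "reduced w"
  shows "foldr push_letter (foldr push_letter u v) w = foldr push_letter u (foldr push_letter v w)"
proof (rule foldr_push[of "{w. reduced w}"])
  show "s \<in> {w. reduced w} \<Longrightarrow> push_letter l s \<in> {w. reduced w} \<and> push_letter (inv_letter l) (push_letter l s) = s"
    for l s using push_inv_push[of s "inv_letter l"] by (simp add: reduced_push)
qed (use assms in simp)

lemma foldr_push_Nil: "reduced u \<Longrightarrow> foldr push_letter u [] = u"
proof (induction u)
  case (Cons l u)
  then have "foldr push_letter u [] = u" by (cases u) auto
  then show ?case using push_reduced[OF Cons.prems] by simp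
qed simp

definition inv_word :: "'a letter list \<Rightarrow> 'a letter list" where
  "inv_word w = rev (map inv_letter w)"

lemma reduced_inv_word: "reduced w \<Longrightarrow> reduced (inv_word w)"
  unfolding inv_word_def successively_rev successively_map
  by (erule successively_mono) (auto simp: inv_letter_def)

lemma foldr_push_inv_word: "foldr push_letter (inv_word w) w = []"
  by (induction w) (simp_all add: inv_word_def)

text \<open>A free group on a whole type, so that it can be an instance of \<open>group_add\<close>;
  free groups on subsets reappear as \<open>letters_in\<close>.\<close>

typedef 'a fg = "reduced_words (UNIV :: 'a set)"
  morphisms word Abs_fg
  by (rule exI[of _ "[]"]) (simp add: reduced_words_UNIV)

lemma reduced_word [simp]: "reduced (word x)"
  using word[of x] by (simp add: reduced_words_UNIV)

lemma word_Abs [simp]: "reduced w \<Longrightarrow> word (Abs_fg w) = w"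
  by (simp add: Abs_fg_inverse reduced_words_UNIV)

instantiation fg :: (type) group_add
begin

definition zero_fg :: "'a fg" where "0 = Abs_fg []"
definition plus_fg :: "'a fg \<Rightarrow> 'a fg \<Rightarrow> 'a fg" where
  "x + y = Abs_fg (foldr push_letter (word x) (word y))"
definition uminus_fg :: "'a fg \<Rightarrow> 'a fg" where "- x = Abs_fg (inv_word (word x))"
definition minus_fg :: "'a fg \<Rightarrow> 'a fg \<Rightarrow> 'a fg" where "x - y = x + - y" for x y :: "'a fg"

instance
proof
  fix x y z :: "'a fg"
  show "x + y + z = x + (y + z)"
    by (simp add: plus_fg_def reduced_foldr_push foldr_push_assoc)
  show "0 + x = x" by (simp add: plus_fg_def zero_fg_def word_inverse)
  show "x + 0 = x" by (simp add: plus_fg_def zero_fg_def foldr_push_Nil word_inverse)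
  show "- x + x = 0"
    by (simp add: plus_fg_def zero_fg_def uminus_fg_def reduced_inv_word foldr_push_inv_word)
  show "x + - y = x - y" by (simp add: minus_fg_def)
qed

end

lemma word_zero [simp]: "word 0 = []" by (simp add: zero_fg_def)

lemma word_plus: "word (x + y) = foldr push_letter (word x) (word y)"
  by (simp add: plus_fg_def reduced_foldr_push)

lemma word_minus: "word (- x) = inv_word (word x)"
  by (simp add: uminus_fg_def reduced_inv_word)

definition of_letter :: "'a letter \<Rightarrow> 'a fg" where "of_letter l = Abs_fg [l]"
definition basis :: "'a \<Rightarrow> 'a fg" where "basis x = of_letter (True, x)"

lemma word_of_letter [simp]: "word (of_letter l) = [l]" by (simp add: of_letter_def)

lemma of_letter_inv: "of_letter (inv_letter l) = - of_letter l"
  by (simp add: word_inject[symmetric] word_minus inv_word_def)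

lemma of_letter_eq: "of_letter l = (if fst l then basis (snd l) else - basis (snd l))"
  using of_letter_inv[of "(True, snd l)"] by (cases l) (simp add: basis_def)

lemma Abs_Cons:
  assumes "reduced (l # w)" shows "Abs_fg (l # w) = of_letter l + Abs_fg w"
proof -
  have "reduced w" using assms by (cases w) auto
  then show ?thesis using assms by (simp add: word_inject[symmetric] word_plus push_reduced)
qed

lemma fg_induct [case_names zero letter]:
  assumes "P 0" "\<And>l x. P x \<Longrightarrow> P (of_letter l + x)"
  shows "P x"
proof -
  have "reduced w \<Longrightarrow> P (Abs_fg w)" for w
  proof (induction w)
    case Nil
    then show ?case using assms(1) by (simp add: zero_fg_def)
  next
    case (Cons l w)
    then have "reduced w" by (cases w) auto
    then show ?case using Cons assms(2) by (simp add: Abs_Cons)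
  qed
  then show ?thesis using reduced_word[of x] word_inverse[of x] by metis
qed

section \<open>Homomorphisms and the universal property\<close>

definition additive_hom :: "('g::group_add \<Rightarrow> 'h::group_add) \<Rightarrow> bool" where
  "additive_hom f \<longleftrightarrow> (\<forall>x y. f (x + y) = f x + f y)"

lemma additive_homD:
  assumes "additive_hom f"
  shows "f (x + y) = f x + f y" "f 0 = 0" "f (- x) = - f x" "f (x - y) = f x - f y"
proof -
  show a: "f (x + y) = f x + f y" for x y using assms by (simp add: additive_hom_def)
  show z: "f 0 = 0" using a[of 0 0] add_left_imp_eq[of "f 0" "f 0" 0] by simp
  show m: "f (- x) = - f x" for x using a[of x "- x"] z minus_unique[of "f x" "f (- x)"] by simp
  show "f (x - y) = f x - f y" using a[of x "- y"] m by simp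
qed

lemma additive_hom_comp: "additive_hom f \<Longrightarrow> additive_hom g \<Longrightarrow> additive_hom (\<lambda>x. f (g x))"
  by (simp add: additive_hom_def)

lemma additive_hom_id: "additive_hom (\<lambda>x. x)"
  by (simp add: additive_hom_def)

lemma additive_hom_kernel:
  assumes "additive_hom f" shows "normal_sub {x. f x = 0}"
  unfolding normal_sub_def
  by (intro conjI add_subgroupI conj_closedI) (simp_all add: cj_def additive_homD[OF assms])

definition lift :: "('a \<Rightarrow> 'h::group_add) \<Rightarrow> 'a fg \<Rightarrow> 'h" where
  "lift h x = foldr (\<lambda>l s. (if fst l then h (snd l) else - h (snd l)) + s) (word x) 0"

lemma additive_hom_lift: "additive_hom (lift h)"
  unfolding additive_hom_def
proof (intro allI)
  fix x y
  let ?f = "\<lambda>l s. (if fst l then h (snd l) else - h (snd l)) + s"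
  have 1: "foldr ?f u s = foldr ?f u 0 + s" for u s by (induction u) (auto simp: add.assoc)
  have "foldr ?f (foldr push_letter (word x) (word y)) 0 = foldr ?f (word x) (foldr ?f (word y) 0)"
    by (rule foldr_push[of UNIV]) (auto simp: inv_letter_def add.assoc[symmetric])
  then show "lift h (x + y) = lift h x + lift h y"
    unfolding lift_def word_plus using 1[of "word x" "foldr ?f (word y) 0"] by simp
qed

lemma lift_basis [simp]: "lift h (basis x) = h x"
  by (simp add: lift_def basis_def)

lemma additive_hom_ext:
  assumes "additive_hom f" "additive_hom g" "\<And>x. f (basis x) = g (basis x)"
  shows "f w = g w"
proof (induction w rule: fg_induct)
  case zero
  then show ?case using assms by (simp add: additive_homD)
next
  case (letter l x)
  then show ?case using assms by (simp add: additive_homD of_letter_eq)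
qed

lemma fg_subgroup_UNIV:
  assumes "add_subgroup H" "\<And>x. basis x \<in> H" shows "x \<in> H"
  by (induction x rule: fg_induct) (simp_all add: of_letter_eq add_subgroupD[OF assms(1)] assms(2))

text \<open>Nielsen--Schreier without bases: the free group acts on \<open>K\<close>-coset representatives decorated
  with elements of \<open>E\<close>, and the stabilizer of the base point gives a section over \<open>K = \<phi> ` E\<close>.\<close>

lemma projective_mod_kernel:
  fixes \<phi> :: "'g::group_add \<Rightarrow> 'x fg"
  assumes hom: "additive_hom \<phi>"
  shows "projective_mod {g. \<phi> g = 0}"
  unfolding projective_mod_def
proof (intro allI impI)
  fix E :: "'g set"
  assume E: "normal_sub E"
  note E' = add_subgroupD[OF normal_subD(1)[OF E]] and h = additive_homD[OF hom]
  define K where "K = \<phi> ` E"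
  have K: "add_subgroup K"
  proof (rule add_subgroupI)
    show "0 \<in> K" using E' h by (metis K_def imageI)
    show "x + y \<in> K" if "x \<in> K" "y \<in> K" for x y
      using that E' unfolding K_def by (auto simp: h(1)[symmetric])
    show "- x \<in> K" if "x \<in> K" for x
      using that E' unfolding K_def by (auto simp: h(3)[symmetric])
  qed
  note K' = add_subgroupD[OF K]
  \<comment> \<open>Representatives of the left cosets of \<open>K\<close>. The coset
    \<open>K\<close> itself gets \<open>0\<close>, which makes \<open>(0, 0)\<close> a base
    point.\<close>
  define \<rho> where "\<rho> g = (if g \<in> K then 0 else SOME r. - r + g \<in> K)" for g
  have \<rho>: "- \<rho> g + g \<in> K" for g
  proof (cases "g \<in> K")
    case False
    have "- g + g \<in> K" using K' by simp
    then have "- (SOME r. - r + g \<in> K) + g \<in> K" by (rule someI[of "\<lambda>r. - r + g \<in> K"])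
    then show ?thesis using False by (simp add: \<rho>_def)
  qed (simp add: \<rho>_def)
  have \<rho>_eq: "\<rho> g = \<rho> g'" if "- g + g' \<in> K" for g g'
  proof -
    have 1: "- r + g' = (- r + g) + (- g + g')" for r
      by (simp add: group_norm del: add_uminus_conv_diff)
    have "- r + g' \<in> K \<longleftrightarrow> - r + g \<in> K" for r
      by (subst 1) (rule add_subgroup_cancel(2)[OF K that])
    moreover from this[of 0] have "g' \<in> K \<longleftrightarrow> g \<in> K" by simp
    ultimately show ?thesis by (simp add: \<rho>_def)
  qed
  have \<rho>_idem: "\<rho> (\<rho> g) = \<rho> g" for g using \<rho>_eq[OF \<rho>] .
  have \<rho>_add: "\<rho> (b + \<rho> g) = \<rho> (b + g)" for b g
  proof (rule \<rho>_eq)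
    show "- (b + \<rho> g) + (b + g) \<in> K"
      using \<rho>[of g] by (simp add: group_norm del: add_uminus_conv_diff)
  qed
  \<comment> \<open>Arbitrary preimages in \<open>E\<close>; additivity of the section
    \<open>s\<close> will come from the action instead.\<close>
  define \<sigma> where "\<sigma> k = (SOME e. e \<in> E \<and> \<phi> e = k)" for k
  have \<sigma>: "\<sigma> k \<in> E" "\<phi> (\<sigma> k) = k" if "k \<in> K" for k
    using someI_ex[of "\<lambda>e. e \<in> E \<and> \<phi> e = k"] that unfolding K_def \<sigma>_def by blast+
  define \<theta> where "\<theta> b v = \<sigma> (- \<rho> (b + v) + (b + v))" for b v
  have \<theta>: "\<theta> b v \<in> E" "\<phi> (\<theta> b v) = - \<rho> (b + v) + (b + v)" for b v
    using \<sigma>[OF \<rho>[of "b + v"]] by (simp_all add: \<theta>_def)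
  \<comment> \<open>A positive letter moves the coset and records a lifted Schreier generator; a
    negative letter is the inverse map, hence the negated generator taken at the new coset.\<close>
  define f where "f l = (\<lambda>(v, e).
      if fst l then (\<rho> (basis (snd l) + v), \<theta> (basis (snd l)) v + e)
      else (\<rho> (- basis (snd l) + v), - \<theta> (basis (snd l)) (\<rho> (- basis (snd l) + v)) + e))" for l
  define \<Omega> where "\<Omega> = {(v, e). \<rho> v = v \<and> e \<in> E}"
  have f\<Omega>: "f l s \<in> \<Omega> \<and> f (inv_letter l) (f l s) = s" if s\<Omega>: "s \<in> \<Omega>" for l s
  proof -
    obtain v e where s: "s = (v, e)" "\<rho> v = v" "e \<in> E" using s\<Omega> by (auto simp: \<Omega>_def)
    obtain c x where l: "l = (c, x)" by (cases l)
    show ?thesis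
      using s E' \<theta>
      by (cases c) (auto simp: l f_def \<Omega>_def \<rho>_idem \<rho>_add add.assoc[symmetric])
  qed
  define act where "act w s = foldr f (word w) s" for w s
  have act_add: "act (u + w) s = act u (act w s)" if "s \<in> \<Omega>" for u w s
    unfolding act_def word_plus by (rule foldr_push[of \<Omega> f, OF f\<Omega> that])
  \<comment> \<open>The action covers left translation: \<open>pos\<close> is equivariant, so acting
    by \<open>w\<close> on the base point gives a pair at position \<open>w\<close>.\<close>
  define pos where "pos = (\<lambda>(v, e). v + \<phi> e)"
  have pos: "pos (f l s) = of_letter l + pos s" if s\<Omega>: "s \<in> \<Omega>" for l s
  proof -
    obtain v e where s: "s = (v, e)" "\<rho> v = v" "e \<in> E" using s\<Omega> by (auto simp: \<Omega>_def)
    obtain c x where l: "l = (c, x)" by (cases l)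
    show ?thesis
      using s
      by (cases c) (simp_all add: l f_def pos_def h \<theta> of_letter_eq \<rho>_add
          group_norm del: add_uminus_conv_diff)
  qed
  have 0: "(0, 0) \<in> \<Omega>" using E' K' by (auto simp: \<Omega>_def \<rho>_def)
  have fold_pos: "pos (foldr f w (0, 0)) = foldr (\<lambda>l x. of_letter l + x) w 0 \<and> foldr f w (0, 0) \<in> \<Omega>" for w
    by (induction w) (use 0 pos f\<Omega> in \<open>auto simp: pos_def h\<close>)
  have red_sum: "reduced w \<Longrightarrow> foldr (\<lambda>l x. of_letter l + x) w 0 = Abs_fg w" for w :: "'x letter list"
  proof (induction w)
    case (Cons l w)
    then have "reduced w" by (cases w) auto
    then show ?case using Cons by (simp add: Abs_Cons)
  qed (simp add: zero_fg_def)
  have act_pos: "pos (act w (0, 0)) = w" and act_mem: "act w (0, 0) \<in> \<Omega>" for w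
    using fold_pos[of "word w"] by (auto simp: act_def red_sum word_inverse)
  \<comment> \<open>The action commutes with right translation in the second component; this makes
    \<open>s\<close> additive.\<close>
  have fold_right: "foldr f w (v, e + c) = (fst (foldr f w (v, e)), snd (foldr f w (v, e)) + c)" for w v e c
    by (induction w) (auto simp: f_def add.assoc split: prod.splits)
  define s where "s x = snd (act (\<phi> x) (0, 0))" for x
  have act_K: "act (\<phi> x) (0, 0) = (0, s x) \<and> s x \<in> E \<and> \<phi> (s x) = \<phi> x" if "x \<in> E" for x
  proof -
    obtain v e where ve: "act (\<phi> x) (0, 0) = (v, e)" by fastforce
    then have v: "\<rho> v = v" "e \<in> E" and p: "v + \<phi> e = \<phi> x"
      using act_mem[of "\<phi> x"] act_pos[of "\<phi> x"] by (auto simp: \<Omega>_def pos_def)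
    have "v = \<phi> x - \<phi> e" using p by (metis add_diff_cancel)
    also have "\<dots> \<in> K" using K' \<open>e \<in> E\<close> that by (simp add: K_def)
    finally have "v = 0" using v by (simp add: \<rho>_def)
    then show ?thesis using ve v p by (simp add: s_def)
  qed
  have "s (x + y) = s x + s y" if "x \<in> E" "y \<in> E" for x y
  proof -
    have "act (\<phi> (x + y)) (0, 0) = act (\<phi> x) (0, 0 + s y)"
      using act_add[OF 0] act_K[OF that(2)] by (simp add: h)
    also have "\<dots> = (0, s x + s y)"
      using act_K[OF that(1)] unfolding act_def fold_right by simp
    finally show ?thesis using act_K[of "x + y"] that E' by simp
  qed
  moreover have "s x = 0" if "\<phi> x = 0" for x using that by (simp add: s_def act_def)
  moreover have "s x \<in> E \<and> x - s x \<in> {g. \<phi> g = 0}" if "x \<in> E" for x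
    using act_K[OF that] by (simp add: h)
  ultimately show "\<exists>s. (\<forall>x\<in>E. s x \<in> E \<and> x - s x \<in> {g. \<phi> g = 0}) \<and>
      (\<forall>x\<in>E. \<forall>y\<in>E. s (x + y) = s x + s y) \<and> (\<forall>x\<in>E \<inter> {g. \<phi> g = 0}. s x = 0)"
    by (intro exI[of _ s]) auto
qed

section \<open>Commutation in free groups\<close>

definition eval_word :: "'a letter list \<Rightarrow> 'a fg" where
  "eval_word w = foldr (\<lambda>l x. of_letter l + x) w 0"

lemma eval_word_simps [simp]: "eval_word [] = 0" "eval_word (l # w) = of_letter l + eval_word w"
  "eval_word (u @ v) = eval_word u + eval_word v"
proof -
  show "eval_word (u @ v) = eval_word u + eval_word v"
    by (induction u) (simp_all add: eval_word_def add.assoc)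
qed (simp_all add: eval_word_def)

lemma eval_word_reduced: "reduced w \<Longrightarrow> eval_word w = Abs_fg w"
proof (induction w)
  case (Cons l w)
  then have "reduced w" by (cases w) auto
  then show ?case using Cons by (simp add: Abs_Cons)
qed (simp add: zero_fg_def)

lemma eval_word_word [simp]: "eval_word (word x) = x"
  by (simp add: eval_word_reduced word_inverse)

lemma word_eval [simp]: "reduced w \<Longrightarrow> word (eval_word w) = w"
  by (simp add: eval_word_reduced)

lemma eval_inv_word: "eval_word (inv_word w) = - eval_word w"
  by (induction w) (simp_all add: inv_word_def of_letter_inv minus_add del: add_uminus_conv_diff)

lemma word_eq_Nil [simp]: "word x = [] \<longleftrightarrow> x = 0"
  by (metis word_inject word_zero)

lemma word_plus_append:
  assumes "word x \<noteq> [] \<Longrightarrow> word y \<noteq> [] \<Longrightarrow> hd (word y) \<noteq> inv_letter (last (word x))"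
  shows "word (x + y) = word x @ word y"
proof -
  have "reduced (word x @ word y)" using assms by (auto simp: successively_append_iff)
  then show ?thesis using word_eval[of "word x @ word y"] by simp
qed

lemma length_push: "length (push_letter l w) \<le> Suc (length w)"
  by (cases w) auto

lemma length_foldr_push: "length (foldr push_letter u w) \<le> length u + length w"
proof (induction u)
  case (Cons l u)
  then show ?case using length_push[of l "foldr push_letter u w"] by simp
qed simp

lemma length_word_plus_cancel:
  assumes "word x \<noteq> []" "word y \<noteq> []" "hd (word y) = inv_letter (last (word x))"
  shows "length (word (x + y)) < length (word x) + length (word y)"
proof -
  obtain u l where u: "word x = u @ [l]" using assms(1) by (metis append_butlast_last_id)
  obtain v where v: "word y = inv_letter l # v" using assms u by (metis last_snoc list.collapse)
  have "word (x + y) = foldr push_letter u v" by (simp add: word_plus u v)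
  then show ?thesis using length_foldr_push[of u v] by (simp add: u v)
qed

text \<open>Without cancellation \<open>x + y\<close> has full length; then so has
  \<open>y + x\<close>, and equality in the group becomes equality of concatenated words.\<close>

lemma word_commute:
  assumes eq: "x + y = y + x"
    and nc: "word x \<noteq> [] \<Longrightarrow> word y \<noteq> [] \<Longrightarrow> hd (word y) \<noteq> inv_letter (last (word x))"
  shows "word x @ word y = word y @ word x"
proof -
  have 1: "word (x + y) = word x @ word y" by (rule word_plus_append[OF nc])
  have "word (y + x) = word y @ word x"
  proof (rule word_plus_append)
    assume "word y \<noteq> []" "word x \<noteq> []"
    then show "hd (word x) \<noteq> inv_letter (last (word y))"
      using length_word_plus_cancel[of y x] arg_cong[OF 1, of length] eq by auto
  qed
  then show ?thesis using 1 eq by simp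
qed

lemma hd_inv_word: "w \<noteq> [] \<Longrightarrow> hd (inv_word w) = inv_letter (last w)"
  and last_inv_word: "w \<noteq> [] \<Longrightarrow> last (inv_word w) = inv_letter (hd w)"
  and inv_word_eq_Nil [simp]: "inv_word w = [] \<longleftrightarrow> w = []"
  by (simp_all add: inv_word_def hd_rev last_rev last_map hd_map)

lemma commute_minus_iff:
  fixes x y :: "'g::group_add"
  assumes "x + y = y + x" shows "x + - y = - y + x"
proof -
  have "- y + (x + y) + - y = - y + (y + x) + - y" using assms by simp
  then show ?thesis by (simp add: add.assoc del: add_uminus_conv_diff)
qed

text \<open>If \<open>b\<close> cancels against the end of \<open>a\<close>, then \<open>- b\<close>
  ends with the last letter of \<open>a\<close>, and nothing cancels in \<open>- b + a\<close>
  because \<open>a\<close> is cyclically reduced.\<close>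

lemma commute_word:
  assumes cyc: "hd (word a) \<noteq> inv_letter (last (word a))" and eq: "a + b = b + a"
  obtains b' where "b' = b \<or> b' = - b" "word a @ word b' = word b' @ word a"
proof (cases "a \<noteq> 0 \<and> b \<noteq> 0 \<and> hd (word b) = inv_letter (last (word a))")
  case False
  then show ?thesis using that[of b] word_commute[OF eq] by auto
next
  case True
  have "word (- b) @ word a = word a @ word (- b)"
  proof (rule word_commute)
    show "- b + a = a + - b" using commute_minus_iff[OF eq] by simp
    show "hd (word a) \<noteq> inv_letter (last (word (- b)))"
      using True cyc by (simp add: word_minus last_inv_word)
  qed
  then show ?thesis using that[of "- b"] by simp
qed

text \<open>Both \<open>u @ v\<close> and \<open>v @ u\<close> are prefixes of a high power of \<open>a\<close>.\<close>

lemma list_commute_trans: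
  assumes a: "a \<noteq> []" "a @ u = u @ a" "a @ v = v @ a"
  shows "u @ v = v @ u"
proof -
  define n where "n = length u + length v"
  define A where "A = concat (replicate n a)"
  have comm: "concat (replicate m a) @ w = w @ concat (replicate m a)" if "a @ w = w @ a" for m w
  proof (induction m)
    case (Suc m)
    then show ?case using that by simp
  qed simp
  have "n \<le> n * length a" using a(1) by (cases a) auto
  then have len: "n \<le> length A" by (simp add: A_def length_concat sum_list_replicate)
  have "a @ (u @ v) = (u @ v) @ a" "a @ (v @ u) = (v @ u) @ a"
    using a by (metis append.assoc)+
  then have "A @ (u @ v) = (u @ v) @ A" "A @ (v @ u) = (v @ u) @ A"
    using comm unfolding A_def by blast+
  then have "take n (A @ (u @ v)) = take n ((u @ v) @ A)" "take n (A @ (v @ u)) = take n ((v @ u) @ A)"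
    by simp_all
  then show ?thesis using len by (simp add: n_def)
qed

text \<open>Commutative transitivity. Conjugation by first letters shortens \<open>a\<close> until
  it is cyclically reduced; then, up to signs of \<open>b\<close> and \<open>c\<close>, the
  equations are equations of words.\<close>

lemma fg_commute_trans:
  fixes a b c :: "'a fg"
  assumes "a \<noteq> 0" "a + b = b + a" "a + c = c + a"
  shows "b + c = c + b"
  using assms
proof (induction "length (word a)" arbitrary: a b c rule: less_induct)
  case less
  show ?case
  proof (cases "hd (word a) = inv_letter (last (word a))")
    case False
    obtain b' where b': "b' = b \<or> b' = - b" "word a @ word b' = word b' @ word a"
      using commute_word[OF False less.prems(2)] .
    obtain c' where c': "c' = c \<or> c' = - c" "word a @ word c' = word c' @ word a"
      using commute_word[OF False less.prems(3)] .
    have "word b' @ word c' = word c' @ word b'"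
      using list_commute_trans[OF _ b'(2) c'(2)] less.prems(1) by simp
    then have eq: "b' + c' = c' + b'" by (metis eval_word_simps(3) eval_word_word)
    then have "b' + - c' = - c' + b'" "c' + - b' = - b' + c'"
      using commute_minus_iff[of b' c'] commute_minus_iff[of c' b'] by simp_all
    moreover from this(2) have "- b' + - c' = - c' + - b'"
      using commute_minus_iff[of "- b'" c'] by simp
    ultimately show ?thesis using b'(1) c'(1) eq by auto
  next
    case True
    obtain l w where a1: "word a = l # w" using less.prems(1) by (metis list.exhaust word_eq_Nil)
    have "w \<noteq> []" using True a1 by auto
    then obtain v l' where a2: "w = v @ [l']" by (metis append_butlast_last_id)
    then have wa: "word a = l # v @ [inv_letter l]" using True a1 by auto
    have rv: "reduced v" using reduced_word[of a] unfolding wa by (auto simp: successively_Cons successively_append_iff)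
    let ?g = "of_letter l"
    have a: "a = ?g + (eval_word v + - ?g)"
      using arg_cong[OF wa, of eval_word] by (simp add: of_letter_inv)
    have "cj (- ?g) a = eval_word v"
      by (subst a) (simp add: cj_def group_norm del: add_uminus_conv_diff)
    then have len: "length (word (cj (- ?g) a)) < length (word a)" using rv wa by simp
    have nz: "cj (- ?g) a \<noteq> 0" using less.prems(1) by (metis cj_inv' cj_zero)
    have "cj (- ?g) b + cj (- ?g) c = cj (- ?g) c + cj (- ?g) b"
      by (rule less.hyps[OF len nz]) (use less.prems in \<open>simp_all add: cj_add[symmetric]\<close>)
    then have "cj (- ?g) (b + c) = cj (- ?g) (c + b)" by (simp add: cj_add)
    then show ?thesis by (metis cj_inv')
  qed
qed

definition spelled_from :: "'a letter \<Rightarrow> 'a fg \<Rightarrow> bool" where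
  "spelled_from l x \<longleftrightarrow> x \<noteq> 0 \<and> hd (word x) = l \<and> last (word x) = l"

text \<open>When each image begins and ends with its own generator, substitution into a reduced word
  causes no cancellation at the junctions, and the first letter survives.\<close>

lemma lift_eq_0_iff:
  assumes h: "\<And>x. spelled_from (True, x) (h x)"
  shows "lift h w = 0 \<longleftrightarrow> w = 0"
proof -
  note hom = additive_homD[OF additive_hom_lift, of h]
  have l: "lift h (of_letter l) \<noteq> 0 \<and> hd (word (lift h (of_letter l))) = l \<and> last (word (lift h (of_letter l))) = l"
    for l
  proof (cases "fst l")
    case True
    then show ?thesis using h[of "snd l"] by (cases l) (auto simp: of_letter_eq spelled_from_def)
  next
    case False
    then show ?thesis using h[of "snd l"]
      by (cases l) (auto simp: of_letter_eq spelled_from_def hom(3) word_minus hd_inv_word last_inv_word)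
  qed
  have "lift h (eval_word w) \<noteq> 0 \<and> hd (word (lift h (eval_word w))) = hd w" if "reduced w" "w \<noteq> []" for w
    using that
  proof (induction w)
    case (Cons k w)
    show ?case
    proof (cases "w = []")
      case True
      then show ?thesis using l[of k] by simp
    next
      case False
      then have IH: "lift h (eval_word w) \<noteq> 0" "hd (word (lift h (eval_word w))) = hd w"
          and ne: "hd w \<noteq> inv_letter k"
        using Cons by (auto simp: successively_Cons)
      have "word (lift h (of_letter k) + lift h (eval_word w)) =
          word (lift h (of_letter k)) @ word (lift h (eval_word w))"
        by (rule word_plus_append) (use l[of k] IH ne in auto)
      then show ?thesis using l[of k] by (auto simp: hom(1) simp flip: word_eq_Nil)
    qed
  qed simp
  from this[of "word w"] show ?thesis using hom(2) by fastforce
qed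

section \<open>A family of coordinate maps\<close>

instance fg :: (countable) countable
  by (rule countable_classI[of "\<lambda>x. to_nat (word x)"]) (simp add: word_inject)

lemma spelled_from_basis: "spelled_from (True, x) (basis x)"
  unfolding spelled_from_def basis_def by (simp flip: word_eq_Nil)

lemma lift_comp:
  assumes "additive_hom f" shows "f (lift h w) = lift (\<lambda>x. f (h x)) w"
  by (rule additive_hom_ext[of "\<lambda>w. f (lift h w)"])
    (simp_all add: additive_hom_comp[OF assms additive_hom_lift] additive_hom_lift)

section \<open>Free factors and retractions\<close>

definition letters_in :: "'a set \<Rightarrow> 'a fg set" where
  "letters_in S = {x. word x \<in> reduced_words S}"

lemma letters_in_iff: "x \<in> letters_in S \<longleftrightarrow> snd ` set (word x) \<subseteq> S"
  by (auto simp: letters_in_def reduced_words_def lists_eq_set)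

lemma set_push: "set (push_letter l w) \<subseteq> insert l (set w)"
  by (cases w) auto

lemma set_foldr_push: "set (foldr push_letter u w) \<subseteq> set u \<union> set w"
proof (induction u)
  case (Cons l u)
  then show ?case using set_push[of l "foldr push_letter u w"] by auto
qed simp

lemma add_subgroup_letters_in: "add_subgroup (letters_in S)"
proof (rule add_subgroupI)
  show "x + y \<in> letters_in S" if "x \<in> letters_in S" "y \<in> letters_in S" for x y
    using that set_foldr_push[of "word x" "word y"] unfolding letters_in_iff word_plus by blast
qed (auto simp: letters_in_iff word_minus inv_word_def image_iff)

lemma basis_letters_in: "basis x \<in> letters_in S \<longleftrightarrow> x \<in> S"
  by (simp add: letters_in_iff basis_def)

lemma lift_in_subgroup:
  assumes "add_subgroup H" "\<And>x. h x \<in> H" shows "lift h w \<in> H"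
proof (induction w rule: fg_induct)
  case zero
  then show ?case using assms by (simp add: additive_homD[OF additive_hom_lift] add_subgroupD)
next
  case (letter l x)
  then show ?case using assms
    by (simp add: additive_homD[OF additive_hom_lift] of_letter_eq add_subgroupD[OF assms(1)])
qed

lemma lift_cong_letters:
  assumes "w \<in> letters_in S" "\<And>x. x \<in> S \<Longrightarrow> h x = h' x" shows "lift h w = lift h' w"
proof -
  have "lift h (eval_word u) = lift h' (eval_word u)" if "snd ` set u \<subseteq> S" for u
    using that
    by (induction u) (simp_all add: additive_homD[OF additive_hom_lift] of_letter_eq assms(2))
  from this[of "word w"] show ?thesis using assms(1) by (simp add: letters_in_iff)
qed

lemma lift_basis_id: "lift basis w = w"
  by (rule additive_hom_ext[OF additive_hom_lift additive_hom_id]) simp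

text \<open>The retraction onto the free factor on the first \<open>d\<close> generators; for
  \<open>d = 4 * k\<close> its kernel is the subgroup \<open>Z\<close> of the general
  theory.\<close>

definition trunc :: "nat \<Rightarrow> nat fg \<Rightarrow> nat fg" where
  "trunc d = lift (\<lambda>y. if y < d then basis y else 0)"

lemma trunc_basis [simp]: "trunc d (basis y) = (if y < d then basis y else 0)"
  by (simp add: trunc_def)

lemma additive_hom_trunc: "additive_hom (trunc d)"
  unfolding trunc_def by (rule additive_hom_lift)

lemma trunc_letters_in: "trunc d w \<in> letters_in {..<d}"
  unfolding trunc_def
  by (rule lift_in_subgroup[OF add_subgroup_letters_in])
    (auto simp: basis_letters_in add_subgroupD(1)[OF add_subgroup_letters_in])

lemma trunc_id: "w \<in> letters_in {..<d} \<Longrightarrow> trunc d w = w"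
  using lift_cong_letters[of w "{..<d}" "\<lambda>y. if y < d then basis y else 0" basis]
  by (simp add: trunc_def lift_basis_id)

text \<open>Coordinate \<open>i\<close> of the generator numbered \<open>4 * j + 2 * e + c\<close> (with \<open>e, c < 2\<close>) is the \<open>c\<close>-th
  basis element if the \<open>j\<close>-th binary digit of \<open>i\<close> is \<open>e\<close>, and trivial otherwise.  Thus any two
  coordinates are separated by a digit, and \<open>4 * k\<close> generators serve \<open>2 ^ k\<close> coordinates.\<close>

definition coord :: "nat \<Rightarrow> nat \<Rightarrow> nat fg \<Rightarrow> nat fg" where
  "coord k i = lift (\<lambda>y. if y div 4 < k \<and> bit i (y div 4) = odd (y div 2) then basis (y mod 2) else 0)"

text \<open>The two basis elements go to the generators for digit \<open>j\<close> that coordinate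
  \<open>i\<close> sees; coordinates with the other digit see nothing of the image.\<close>

definition spread :: "nat \<Rightarrow> nat \<Rightarrow> nat fg \<Rightarrow> nat fg" where
  "spread i j = lift (\<lambda>x. if x < 2 then basis (4 * j + 2 * of_bool (bit i j) + x) else 0)"

lemma additive_hom_coord: "additive_hom (coord k i)"
  and additive_hom_spread: "additive_hom (spread i j)"
  by (simp_all add: coord_def spread_def additive_hom_lift)

lemma coord_trunc: "coord k i (trunc (4 * k) w) = coord k i w"
proof (rule additive_hom_ext[of "\<lambda>w. coord k i (trunc (4 * k) w)"])
  fix y show "coord k i (trunc (4 * k) (basis y)) = coord k i (basis y)"
    using additive_homD(2)[OF additive_hom_coord, of k i]
    by (auto simp: coord_def div_less_iff_less_mult mult.commute)
qed (simp_all add: additive_hom_coord additive_hom_comp additive_hom_trunc)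

lemma coord_eq_0: "trunc (4 * k) w = 0 \<Longrightarrow> coord k i w = 0"
  using coord_trunc[of k i w] additive_homD(2)[OF additive_hom_coord, of k i] by simp

lemma coord_spread:
  assumes "j < k"
  shows "coord k i (spread i' j w) = (if bit i j = bit i' j then trunc 2 w else 0)"
proof -
  note z = additive_homD(2)[OF additive_hom_coord, of k i]
  have "(4 * j + 2 * of_bool b + x) div 4 = j" "(4 * j + 2 * of_bool b + x) mod 2 = x"
    "odd ((4 * j + 2 * of_bool b + x) div 2) = b" if "x < 2" for x and b :: bool
    using that by (cases b; auto simp: less_2_cases_iff; presburger)+
  then have *: "coord k i (if x < 2 then basis (4 * j + 2 * of_bool (bit i' j) + x) else 0) =
      (if bit i j = bit i' j \<and> x < 2 then basis x else 0)" for x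
    using assms z by (simp add: coord_def)
  have "lift (\<lambda>x. 0 :: nat fg) w = 0"
    by (rule additive_hom_ext[OF additive_hom_lift]) (simp_all add: additive_hom_def)
  then show ?thesis
    unfolding spread_def lift_comp[OF additive_hom_coord] * by (simp add: trunc_def)
qed

lemma trunc_coord: "trunc 2 (coord k i w) = coord k i w"
proof (rule additive_hom_ext[of "\<lambda>w. trunc 2 (coord k i w)"])
  fix y show "trunc 2 (coord k i (basis y)) = coord k i (basis y)"
    using additive_homD(2)[OF additive_hom_trunc] by (simp add: coord_def)
qed (simp_all add: additive_hom_coord additive_hom_comp additive_hom_trunc)

lemma separating_bit:
  assumes "i < 2 ^ k" "i' < 2 ^ k" "i \<noteq> (i'::nat)"
  obtains j where "j < k" "bit i j \<noteq> bit i' j"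
proof -
  obtain j where j: "bit i j \<noteq> bit i' j" using assms(3) by (auto simp: bit_eq_iff)
  have "j < k"
  proof (rule ccontr)
    assume "\<not> j < k"
    then have "\<not> bit (take_bit k i) j" "\<not> bit (take_bit k i') j" by (simp_all add: bit_take_bit_iff)
    then show False using j assms(1,2) by (simp add: take_bit_nat_eq_self)
  qed
  then show ?thesis using j that by blast
qed

locale binary_family =
  fixes k m :: nat
  assumes k: "0 < k" and m: "m \<le> 2 ^ k"
begin

abbreviation ker :: "nat \<Rightarrow> nat fg set" where "ker i \<equiv> {g. coord k i g = 0}"
abbreviation Z :: "nat fg set" where "Z \<equiv> {g. trunc (4 * k) g = 0}"

lemma separate:
  assumes "i < m" "i' < m" "i \<noteq> i'"
  obtains j where "j < k" "\<And>w. coord k i (spread i j w) = trunc 2 w" "\<And>w. coord k i' (spread i j w) = 0"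
proof -
  obtain j where "j < k" "bit i j \<noteq> bit i' j"
    using separating_bit[of i k i'] assms m by auto
  then show ?thesis using that coord_spread by auto
qed

text \<open>\<open>\<psi>\<close> is an idempotent endomorphism with the same kernel as the
  coordinate. Modulo the elements \<open>basis y - \<psi> (basis y)\<close> and \<open>Z\<close> it
  is the identity, so these normally generate the kernel.\<close>

lemma fin_normally_generated_ker: "fin_normally_generated Z (ker i)"
proof -
  define \<psi> where "\<psi> = (\<lambda>g. spread i 0 (coord k i g))"
  define T where "T = (\<lambda>y. basis y - \<psi> (basis y)) ` {..<4 * k}"
  have h\<psi>: "additive_hom \<psi>"
    unfolding \<psi>_def by (rule additive_hom_comp[OF additive_hom_spread additive_hom_coord])
  note \<psi> = additive_homD[OF h\<psi>] and c = additive_homD[OF additive_hom_coord, of k i]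
  have nK: "normal_sub (ker i)" by (rule additive_hom_kernel[OF additive_hom_coord])
  have c\<psi>: "coord k i (\<psi> g) = coord k i g" for g
    using coord_spread[OF k, of i i] by (simp add: \<psi>_def trunc_coord)
  have ZK: "Z \<subseteq> ker i" using coord_eq_0 by blast
  let ?D = "ncl (T \<union> Z)"
  have D: "normal_sub ?D" by (rule normal_sub_ncl)
  note D' = add_subgroupD[OF normal_subD(1)[OF D]]
  have "add_subgroup {g. g - \<psi> g \<in> ?D}"
  proof (rule add_subgroupI)
    show "0 \<in> {g. g - \<psi> g \<in> ?D}" using D' \<psi> by simp
  next
    fix x y assume *: "x \<in> {g. g - \<psi> g \<in> ?D}" "y \<in> {g. g - \<psi> g \<in> ?D}"
    have "x + y - \<psi> (x + y) = cj x (y - \<psi> y) + (x - \<psi> x)"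
      by (simp add: \<psi> cj_def group_norm del: add_uminus_conv_diff)
    moreover have "cj x (y - \<psi> y) \<in> ?D" using * normal_subD(3)[OF D] by blast
    ultimately show "x + y \<in> {g. g - \<psi> g \<in> ?D}" using * D'(2) by simp
  next
    fix x assume *: "x \<in> {g. g - \<psi> g \<in> ?D}"
    have "- x - \<psi> (- x) = cj (- x) (- (x - \<psi> x))"
      by (simp add: \<psi> cj_def group_norm del: add_uminus_conv_diff)
    also have "\<dots> \<in> ?D" using * D'(3) normal_subD(3)[OF D] by blast
    finally show "- x \<in> {g. g - \<psi> g \<in> ?D}" by simp
  qed
  moreover have "basis y \<in> {g. g - \<psi> g \<in> ?D}" for y
  proof (cases "y < 4 * k")
    case True
    then show ?thesis by (auto simp: T_def intro: op_hull.base)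
  next
    case False
    then have Zy: "trunc (4 * k) (basis y) = 0" by simp
    then have "basis y \<in> ?D" by (auto intro: op_hull.base)
    moreover have "\<psi> (basis y) = 0"
      using coord_eq_0[OF Zy] additive_homD(2)[OF additive_hom_spread] by (simp add: \<psi>_def)
    ultimately show ?thesis by simp
  qed
  ultimately have all: "g - \<psi> g \<in> ?D" for g using fg_subgroup_UNIV by blast
  have "ker i \<subseteq> ?D"
  proof
    fix g assume "g \<in> ker i"
    then have "\<psi> g = 0" using additive_homD(2)[OF additive_hom_spread] by (simp add: \<psi>_def)
    then show "g \<in> ?D" using all[of g] by simp
  qed
  moreover have "?D \<subseteq> ker i"
    by (rule ncl_least[OF nK]) (use ZK in \<open>auto simp: T_def c c\<psi>\<close>)
  ultimately show ?thesis unfolding fin_normally_generated_def T_def by blast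
qed

sublocale comaximal_family "basis ` {..<4 * k}" Z ker m
proof
  show "normal_sub Z" by (rule additive_hom_kernel[OF additive_hom_trunc])
  show "finite (basis ` {..<4 * k})" by simp
  show "gen (basis ` {..<4 * k} \<union> Z) = UNIV"
  proof -
    have "basis y \<in> gen (basis ` {..<4 * k} \<union> Z)" for y
      by (rule op_hull.base) auto
    then show ?thesis using fg_subgroup_UNIV[OF add_subgroup_hull] by blast
  qed
  fix i
  show "normal_sub (ker i)" by (rule additive_hom_kernel[OF additive_hom_coord])
  show "Z \<subseteq> ker i" using coord_eq_0 by blast
  show "fin_normally_generated Z (ker i)" by (rule fin_normally_generated_ker)
  show "projective_mod (ker i)" by (rule projective_mod_kernel[OF additive_hom_coord])
  fix i' assume i: "i < m" "i' < m" "i \<noteq> i'"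
  obtain j where j: "\<And>w. coord k i (spread i j w) = trunc 2 w" "\<And>w. coord k i' (spread i j w) = 0"
    using separate[OF i] by metis
  show "ker i + ker i' = UNIV"
  proof (rule equalityI[OF subset_UNIV subsetI])
    fix g :: "nat fg"
    \<comment> \<open>A copy of coordinate \<open>i\<close> of \<open>g\<close> that is invisible to
      \<open>i'\<close>; subtracting it from \<open>g\<close> leaves an element invisible to
      \<open>i\<close>.\<close>
    let ?s = "spread i j (coord k i g)"
    have "g - ?s \<in> ker i"
      using j(1) trunc_coord additive_homD(4)[OF additive_hom_coord] by simp
    moreover have "?s \<in> ker i'" using j(2) by simp
    ultimately have "(g - ?s) + ?s \<in> ker i + ker i'" by (rule set_plus_intro)
    then show "g \<in> ker i + ker i'" by simp
  qed
qed

text \<open>Coordinates are killed one after the other by commutators with elements that are trivial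
  there, while coordinate \<open>i\<close> keeps a reduced form beginning and ending with
  \<open>x\<close>.\<close>

lemma isolating_element:
  assumes i: "i < m" and x: "x < 2" and I: "finite I" "I \<subseteq> {..<m} - {i}"
  shows "\<exists>p. (\<forall>i'\<in>I. coord k i' p = 0) \<and> spelled_from (True, x) (coord k i p)"
  using I
proof (induction I)
  case empty
  have "coord k i (spread i 0 (basis x)) = basis x" using x by (simp add: coord_spread[OF k])
  then show ?case using spelled_from_basis by (metis empty_iff)
next
  case (insert i' I)
  then obtain p where p: "\<And>l. l \<in> I \<Longrightarrow> coord k l p = 0" "spelled_from (True, x) (coord k i p)" by auto
  obtain j where j: "\<And>w. coord k i (spread i j w) = trunc 2 w" "\<And>w. coord k i' (spread i j w) = 0"
    using separate[of i i'] insert.prems i by (metis Diff_iff insert_subset lessThan_iff singletonI)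
  define y where "y = 1 - x"
  have y: "y < 2" "y \<noteq> x" using x by (auto simp: y_def less_2_cases_iff)
  define a b where "a = spread i j (basis x)" and "b = spread i j (basis y)"
  \<comment> \<open>Both commutators involve \<open>p\<close>, trivial on \<open>I\<close>, and
    \<open>a\<close>, \<open>b\<close>, trivial at \<open>i'\<close>. The second one makes the word
    end in \<open>x\<close> rather than its inverse; wherever \<open>x\<close> would meet its
    inverse, \<open>y\<close> or its inverse stands between.\<close>
  define q where "q = comm (a + b) p + comm (- p) (- a + b)"
  have ci: "coord k i a = basis x" "coord k i b = basis y" using x y by (simp_all add: a_def b_def j)
  have ci': "coord k i' a = 0" "coord k i' b = 0" by (simp_all add: a_def b_def j)
  have chom: "coord k l (comm u v) = comm (coord k l u) (coord k l v)" for l u v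
    by (simp add: comm_def additive_homD[OF additive_hom_coord])
  have cq: "coord k l q = comm (coord k l a + coord k l b) (coord k l p) +
      comm (- coord k l p) (- coord k l a + coord k l b)" for l
    unfolding q_def additive_homD(1)[OF additive_hom_coord] chom
    by (simp add: additive_homD[OF additive_hom_coord])
  have 0: "coord k l q = 0" if "l \<in> insert i' I" for l
  proof (cases "l = i'")
    case True
    then show ?thesis using cq[of l] ci' by simp
  next
    case False
    then show ?thesis using cq[of l] p(1)[of l] that by simp
  qed
  define P where "P = word (coord k i p)"
  have P: "P \<noteq> []" "hd P = (True, x)" "last P = (True, x)" "reduced P"
    using p(2) by (simp_all add: P_def spelled_from_def)
  define P' where "P' = inv_word P"
  have P': "P' \<noteq> []" "hd P' = (False, x)" "last P' = (False, x)" "reduced P'"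
    using P by (simp_all add: P'_def hd_inv_word last_inv_word reduced_inv_word)
  let ?A = "(True, x)" and ?B = "(True, y)" and ?A' = "(False, x)" and ?B' = "(False, y)"
  let ?w = "[?A, ?B] @ P @ [?B', ?A'] @ P' @ P' @ [?A', ?B] @ P @ [?B', ?A]"
  have eP: "eval_word P = coord k i p" "eval_word P' = - coord k i p"
    by (simp_all add: P_def P'_def eval_inv_word)
  have "eval_word ?w = coord k i q"
    unfolding cq ci eval_word_simps eP
    by (simp add: of_letter_eq comm_def group_norm del: add_uminus_conv_diff)
  moreover have "reduced ?w"
    using P P' y by (simp add: successively_append_iff successively_Cons)
  ultimately have "word (coord k i q) = ?w" using word_eval by metis
  then have "spelled_from ?A (coord k i q)"
    by (simp add: spelled_from_def flip: word_eq_Nil)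
  then show ?case using 0 by blast
qed

lemma isolated_free_subgroup:
  assumes i: "i < m"
  obtains \<eta> :: "nat fg \<Rightarrow> nat fg" where "additive_hom \<eta>" "\<And>i' w. i' < m \<Longrightarrow> i' \<noteq> i \<Longrightarrow> coord k i' (\<eta> w) = 0"
    "\<And>w. w \<in> letters_in {..<2} \<Longrightarrow> coord k i (\<eta> w) = 0 \<longleftrightarrow> w = 0"
proof -
  have "\<forall>x. \<exists>p. x < 2 \<longrightarrow> (\<forall>i'\<in>{..<m} - {i}. coord k i' p = 0) \<and> spelled_from (True, x) (coord k i p)"
    using isolating_element[OF i _ _ subset_refl] by simp
  then obtain h where h: "\<And>x i'. x < 2 \<Longrightarrow> i' < m \<Longrightarrow> i' \<noteq> i \<Longrightarrow> coord k i' (h x) = 0"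
      "\<And>x. x < 2 \<Longrightarrow> spelled_from (True, x) (coord k i (h x))"
    by (metis Diff_iff lessThan_iff singletonD)
  define \<eta> where "\<eta> = lift (\<lambda>x. if x < 2 then h x else 0)"
  note c0 = additive_homD(2)[OF additive_hom_coord]
  show ?thesis
  proof (rule that)
    show "additive_hom \<eta>" unfolding \<eta>_def by (rule additive_hom_lift)
    show "coord k i' (\<eta> w) = 0" if "i' < m" "i' \<noteq> i" for i' w
    proof -
      have "(\<lambda>x. coord k i' (if x < 2 then h x else 0)) = (\<lambda>x. 0)" using h(1) that c0 by auto
      moreover have "lift (\<lambda>x. 0 :: nat fg) w = 0"
        by (rule additive_hom_ext[OF additive_hom_lift]) (simp_all add: additive_hom_def)
      ultimately show ?thesis unfolding \<eta>_def lift_comp[OF additive_hom_coord] by simp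
    qed
    show "coord k i (\<eta> w) = 0 \<longleftrightarrow> w = 0" if "w \<in> letters_in {..<2}" for w
    proof -
      \<comment> \<open>Beyond the two letters of interest the default is \<open>basis x\<close>, so
        that the no-cancellation criterion applies to all generators.\<close>
      define h' where "h' x = (if x < 2 then coord k i (h x) else basis x)" for x
      have "coord k i (\<eta> w) = lift h' w"
        unfolding \<eta>_def lift_comp[OF additive_hom_coord]
        by (rule lift_cong_letters[OF that]) (simp add: h'_def)
      moreover have "lift h' w = 0 \<longleftrightarrow> w = 0"
        by (rule lift_eq_0_iff) (use h(2) spelled_from_basis in \<open>auto simp: h'_def\<close>)
      ultimately show ?thesis by simp
    qed
  qed
qed

end

section \<open>The groups and their invariants\<close>

lemma carrier_free_group [simp]: "carrier (free_group S) = reduced_words S"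
  and mult_free_group [simp]: "u \<otimes>\<^bsub>free_group S\<^esub> v = foldr push_letter u v"
  and one_free_group [simp]: "\<one>\<^bsub>free_group S\<^esub> = []"
  by (simp_all add: free_group_def)

lemma reduced_wordsE:
  assumes "w \<in> reduced_words S"
  obtains x where "w = word x" "x \<in> letters_in S"
proof -
  have "word (Abs_fg w) = w" using assms by (simp add: reduced_words_def)
  then show ?thesis using that[of "Abs_fg w"] assms by (simp add: letters_in_def)
qed

lemma group_free_group: "group (free_group S)"
proof (rule groupI)
  note sub = add_subgroupD[OF add_subgroup_letters_in[of S]]
  show "\<one>\<^bsub>free_group S\<^esub> \<in> carrier (free_group S)"
    using sub(1) by (simp add: letters_in_def)
  fix u assume "u \<in> carrier (free_group S)"
  then obtain x where x: "u = word x" "x \<in> letters_in S" by (auto elim: reduced_wordsE)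
  show "\<one>\<^bsub>free_group S\<^esub> \<otimes>\<^bsub>free_group S\<^esub> u = u" by simp
  show "\<exists>v\<in>carrier (free_group S). v \<otimes>\<^bsub>free_group S\<^esub> u = \<one>\<^bsub>free_group S\<^esub>"
    using x sub(3) by (intro bexI[of _ "word (- x)"]) (simp_all add: word_plus[symmetric] letters_in_def)
  fix v assume "v \<in> carrier (free_group S)"
  then obtain y where y: "v = word y" "y \<in> letters_in S" by (auto elim: reduced_wordsE)
  show "u \<otimes>\<^bsub>free_group S\<^esub> v \<in> carrier (free_group S)"
    using x y sub(2) by (simp add: word_plus[symmetric] letters_in_def)
  fix w assume "w \<in> carrier (free_group S)"
  then obtain z where z: "w = word z" by (auto elim: reduced_wordsE)
  show "u \<otimes>\<^bsub>free_group S\<^esub> v \<otimes>\<^bsub>free_group S\<^esub> w = u \<otimes>\<^bsub>free_group S\<^esub> (v \<otimes>\<^bsub>free_group S\<^esub> w)"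
    by (simp add: x y z foldr_push_assoc)
qed

lemma inv_free_group:
  assumes "x \<in> letters_in S" shows "inv\<^bsub>free_group S\<^esub> word x = word (- x)"
  using assms add_subgroupD(3)[OF add_subgroup_letters_in[of S], of x]
  by (intro group.inv_equality[OF group_free_group]) (simp_all add: word_plus[symmetric] letters_in_def)

lemma fg_noncommuting: "basis 0 + basis 1 \<noteq> basis 1 + (basis 0 :: nat fg)"
  by (simp add: word_inject[symmetric] word_plus basis_def)

text \<open>By commutative transitivity a nontrivial \<open>x\<close> would force the two basis
  elements to commute.\<close>

lemma fg_centralizer_basis:
  fixes x :: "nat fg"
  assumes "x + basis 0 = basis 0 + x" "x + basis 1 = basis 1 + x" shows "x = 0"
  using fg_commute_trans[OF _ assms] fg_noncommuting by blast

context binary_family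
begin

text \<open>The tuple of coordinates determines the class modulo \<open>isect m\<close>; numbering
  the tuples places all groups on the type \<open>nat\<close>.\<close>

definition code :: "nat fg \<Rightarrow> nat" where
  "code g = to_nat (map (\<lambda>i. coord k i g) [0..<m])"

text \<open>Decoding picks an arbitrary preimage; the product is well defined because all preimages
  of a code have the same coordinates below \<open>m\<close>.\<close>

definition B :: "nat monoid" where
  "B = \<lparr>carrier = range code, mult = (\<lambda>a b. code (inv_into UNIV code a + inv_into UNIV code b)), one = code 0\<rparr>"

lemma code_eq_iff: "code g = code h \<longleftrightarrow> (\<forall>i<m. coord k i g = coord k i h)"
  by (auto simp: code_def)

lemma coord_decode: "i < m \<Longrightarrow> coord k i (inv_into UNIV code (code g)) = coord k i g"
  using f_inv_into_f[OF rangeI[of code g]] by (simp add: code_eq_iff)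

lemma carrier_B [simp]: "carrier B = range code" and one_B [simp]: "\<one>\<^bsub>B\<^esub> = code 0"
  by (simp_all add: B_def)

lemma mult_B [simp]: "code g \<otimes>\<^bsub>B\<^esub> code h = code (g + h)"
  by (simp add: B_def code_eq_iff coord_decode additive_homD(1)[OF additive_hom_coord])

lemma group_B: "group B"
proof (rule groupI)
  show "\<exists>y\<in>carrier B. y \<otimes>\<^bsub>B\<^esub> x = \<one>\<^bsub>B\<^esub>" if x: "x \<in> carrier B" for x
  proof -
    obtain g where "x = code g" using x by auto
    then show ?thesis by (intro bexI[of _ "code (- g)"]) simp_all
  qed
qed (auto simp: add.assoc)

lemma inv_B [simp]: "inv\<^bsub>B\<^esub> code g = code (- g)"
  by (rule group.inv_equality[OF group_B]) simp_all

lemma code_trunc: "code (trunc (4 * k) g) = code g"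
  by (simp add: code_eq_iff coord_trunc)

lemma code_eq_0_iff: "code g = code 0 \<longleftrightarrow> g \<in> isect m"
  by (auto simp: code_eq_iff isect_def additive_homD(2)[OF additive_hom_coord])

text \<open>As \<open>T\<close> and \<open>Z\<close> normally generate \<open>isect m\<close>, the
  truncations of \<open>T\<close> are defining relators on the first \<open>4 * k\<close>
  generators.\<close>

lemma finitely_presented_B: "finitely_presented B"
proof -
  let ?G = "free_group {..<4 * k}"
  let ?h = "\<lambda>w. code (Abs_fg w)"
  have h_word [simp]: "?h (word x) = code x" for x by (simp add: word_inverse)
  obtain T where T: "finite T" "isect m = ncl (T \<union> Z)"
    using fin_normally_generated_isect[OF order_refl] unfolding fin_normally_generated_def by blast
  define R where "R = (\<lambda>g. word (trunc (4 * k) g)) ` T"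
  have RG: "R \<subseteq> carrier ?G"
    using trunc_letters_in by (auto simp: R_def letters_in_def)
  have hom: "?h \<in> hom ?G B"
    by (rule homI) (auto elim!: reduced_wordsE simp: word_plus[symmetric] word_inverse)
  interpret h: group_hom ?G B ?h
    using hom group_free_group group_B by (simp add: group_hom_def group_hom_axioms_def)
  have "code g \<in> ?h ` carrier ?G" for g
    using trunc_letters_in[of "4 * k" g]
    by (intro image_eqI[of _ _ "word (trunc (4 * k) g)"]) (simp_all add: code_trunc letters_in_def)
  then have onto: "?h ` carrier ?G = carrier B" by auto
  have kernel: "kernel ?G B ?h = normal_closure ?G R"
  proof
    have "R \<subseteq> kernel ?G B ?h"
    proof
      fix r assume "r \<in> R"
      then obtain t where t: "t \<in> T" "r = word (trunc (4 * k) t)" by (auto simp: R_def)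
      then have "code t = code 0" unfolding code_eq_0_iff T(2) by (auto intro: op_hull.base)
      then show "r \<in> kernel ?G B ?h"
        using t(2) trunc_letters_in[of "4 * k" t] by (simp add: kernel_def code_trunc letters_in_def)
    qed
    then show "normal_closure ?G R \<subseteq> kernel ?G B ?h"
      unfolding normal_closure_def using h.normal_kernel by blast
    show "kernel ?G B ?h \<subseteq> normal_closure ?G R"
      unfolding normal_closure_def
    proof (rule Inter_greatest)
      fix N assume "N \<in> {N. N \<lhd> ?G \<and> R \<subseteq> N}"
      then have N: "N \<lhd> ?G" "R \<subseteq> N" by auto
      interpret N: normal N ?G by (rule N(1))
      \<comment> \<open>Pulled back along the truncation, \<open>N\<close> becomes a normal subgroup
        of the large free group that contains \<open>T\<close> and \<open>Z\<close>, hence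
        \<open>isect m\<close>.\<close>
      define N' where "N' = {g. word (trunc (4 * k) g) \<in> N}"
      note t = additive_homD[OF additive_hom_trunc, of "4 * k"]
      have "add_subgroup N'"
      proof (rule add_subgroupI)
        show "0 \<in> N'" using N.one_closed by (simp add: N'_def t)
        show "x + y \<in> N'" if "x \<in> N'" "y \<in> N'" for x y
          using that N.m_closed by (simp add: N'_def t word_plus)
        show "- x \<in> N'" if "x \<in> N'" for x
          using that N.m_inv_closed[of "word (trunc (4 * k) x)"]
          by (simp add: N'_def t inv_free_group[OF trunc_letters_in])
      qed
      moreover have "cj g x \<in> N'" if "x \<in> N'" for g x
      proof -
        have "word (trunc (4 * k) g) \<otimes>\<^bsub>?G\<^esub> word (trunc (4 * k) x) \<otimes>\<^bsub>?G\<^esub> inv\<^bsub>?G\<^esub> word (trunc (4 * k) g) \<in> N"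
          using that trunc_letters_in[of "4 * k" g]
          by (intro N.inv_op_closed2) (simp_all add: N'_def letters_in_def)
        then show ?thesis
          by (simp add: N'_def cj_def t inv_free_group[OF trunc_letters_in] word_plus[symmetric])
      qed
      ultimately have "normal_sub N'" by (simp add: normal_sub_def conj_closed_def)
      moreover have "T \<union> Z \<subseteq> N'"
        using N(2) N.one_closed by (auto simp: N'_def R_def)
      ultimately have sub: "isect m \<subseteq> N'" unfolding T(2) by (rule ncl_least)
      show "kernel ?G B ?h \<subseteq> N"
      proof
        fix w assume w: "w \<in> kernel ?G B ?h"
        then have "w \<in> reduced_words {..<4 * k}" by (simp add: kernel_def)
        then obtain x where x: "w = word x" "x \<in> letters_in {..<4 * k}" by (rule reduced_wordsE)
        have "code x = code 0" using w by (simp add: kernel_def x(1))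
        then have "x \<in> N'" using sub by (auto simp: code_eq_0_iff)
        then show "w \<in> N" using x by (simp add: N'_def trunc_id)
      qed
    qed
  qed
  have "?G Mod kernel ?G B ?h \<cong> B" by (rule h.FactGroup_iso[OF onto])
  then have "B \<cong> ?G Mod kernel ?G B ?h"
    by (rule group.iso_sym[OF normal.factorgroup_is_group[OF h.normal_kernel]])
  then have "B \<cong> ?G Mod normal_closure ?G R" by (simp only: kernel)
  moreover have "finite R" using T(1) by (simp add: R_def)
  ultimately show ?thesis
    unfolding finitely_presented_def using RG by (intro exI[of _ "{..<4 * k}"] exI[of _ R]) auto
qed

lemma coord_spread_basis: "c < 2 \<Longrightarrow> coord k i (spread i 0 (basis c)) = basis c"
  by (simp add: coord_spread[OF k])

text \<open>Every coordinate map attains both basis elements, so each coordinate of a central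
  element commutes with both.\<close>

lemma centerless_B: "centerless B"
proof -
  have "z = code 0" if z: "z \<in> center B" for z
  proof -
    obtain x where x: "z = code x" using z by (auto simp: center_def)
    have comm: "coord k i x + coord k i g = coord k i g + coord k i x" if "i < m" for i g
    proof -
      have "z \<otimes>\<^bsub>B\<^esub> code g = code g \<otimes>\<^bsub>B\<^esub> z" using z by (simp add: center_def)
      then show ?thesis using that by (simp add: x code_eq_iff additive_homD(1)[OF additive_hom_coord])
    qed
    have "coord k i x = 0" if "i < m" for i
      using comm[OF that, of "spread i 0 (basis 0)"] comm[OF that, of "spread i 0 (basis 1)"]
      by (intro fg_centralizer_basis) (simp_all add: coord_spread_basis)
    then show ?thesis by (simp add: x code_eq_0_iff isect_def)
  qed
  moreover have "code 0 \<in> center B" by (auto simp: center_def)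
  ultimately have "center B = {code 0}" by blast
  then show ?thesis by (simp add: centerless_def)
qed

text \<open>The coordinates themselves are the separating homomorphisms.\<close>

lemma residually_free_B: "residually_free B"
  unfolding residually_free_def
proof
  fix a assume "a \<in> carrier B - {\<one>\<^bsub>B\<^esub>}"
  then obtain x where x: "a = code x" "code x \<noteq> code 0" by auto
  then obtain i where i: "i < m" "coord k i x \<noteq> 0" by (auto simp: code_eq_0_iff isect_def)
  let ?f = "\<lambda>b. word (coord k i (inv_into UNIV code b))"
  have "?f \<in> hom B (free_group UNIV)"
    using i(1) by (intro homI)
      (auto simp: reduced_words_UNIV coord_decode word_plus[symmetric] additive_homD(1)[OF additive_hom_coord])
  moreover have "?f a \<noteq> \<one>\<^bsub>free_group UNIV\<^esub>" using i by (simp add: x coord_decode)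
  ultimately show "\<exists>(S :: nat set). \<exists>\<phi>\<in>hom B (free_group S). \<phi> a \<noteq> \<one>\<^bsub>free_group S\<^esub>"
    by (intro exI[of _ UNIV] bexI[of _ ?f])
qed

lemma min_generators_B: "min_generators B \<le> 4 * k"
proof -
  let ?S = "code ` basis ` {..<4 * k}"
  have sub: "?S \<subseteq> carrier B" by auto
  have "add_subgroup {g. code g \<in> generate B ?S}"
  proof (rule add_subgroupI)
    show "0 \<in> {g. code g \<in> generate B ?S}" using generate.one[of B ?S] by simp
    show "x + y \<in> {g. code g \<in> generate B ?S}"
      if "x \<in> {g. code g \<in> generate B ?S}" "y \<in> {g. code g \<in> generate B ?S}" for x y
      using that generate.eng[of "code x" B ?S "code y"] by simp
    show "- x \<in> {g. code g \<in> generate B ?S}" if "x \<in> {g. code g \<in> generate B ?S}" for x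
      using that group.generate_m_inv_closed[OF group_B sub, of "code x"] by simp
  qed
  moreover have "basis y \<in> {g. code g \<in> generate B ?S}" for y
  proof (cases "y < 4 * k")
    case True
    then show ?thesis by (auto intro: generate.incl)
  next
    case False
    then have "code (basis y) = code 0" using code_trunc[of "basis y"] by simp
    then show ?thesis using generate.one[of B ?S] by simp
  qed
  ultimately have "code g \<in> generate B ?S" for g using fg_subgroup_UNIV by blast
  then have "generate B ?S = carrier B"
    using group.generate_in_carrier[OF group_B sub] by auto
  then have "min_generators B \<le> card ?S"
    unfolding min_generators_def using sub by (intro Least_le exI[of _ ?S]) auto
  also have "\<dots> \<le> card {..<4 * k}" unfolding image_image by (rule card_image_le) simp
  finally show ?thesis by simp
qed

text \<open>The isolated free subgroups of the \<open>m\<close> coordinates form a direct product: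
  coordinate \<open>j\<close> of the sum sees only the summand from \<open>\<eta> j\<close>.\<close>

lemma contains_F2_power_B: "contains_F2_power B m"
proof -
  let ?F = "free_group {..<2::nat}"
  let ?P = "product_group {..<m} (\<lambda>_. ?F)"
  have "\<forall>i. \<exists>\<eta> :: nat fg \<Rightarrow> nat fg. i < m \<longrightarrow> additive_hom \<eta> \<and>
      (\<forall>i' w. i' < m \<longrightarrow> i' \<noteq> i \<longrightarrow> coord k i' (\<eta> w) = 0) \<and>
      (\<forall>w\<in>letters_in {..<2}. coord k i (\<eta> w) = 0 \<longleftrightarrow> w = 0)"
    using isolated_free_subgroup by metis
  then obtain \<eta> :: "nat \<Rightarrow> nat fg \<Rightarrow> nat fg" where \<eta>: "\<And>i. i < m \<Longrightarrow> additive_hom (\<eta> i)"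
      "\<And>i i' w. i < m \<Longrightarrow> i' < m \<Longrightarrow> i' \<noteq> i \<Longrightarrow> coord k i' (\<eta> i w) = 0"
      "\<And>i w. i < m \<Longrightarrow> w \<in> letters_in {..<2} \<Longrightarrow> coord k i (\<eta> i w) = 0 \<longleftrightarrow> w = 0"
    by metis
  define s where "s f n = sum_list (map (\<lambda>i. \<eta> i (Abs_fg (f i))) [0..<n])" for f n
  define \<Psi> where "\<Psi> f = code (s f m)" for f
  have s: "coord k j (s f n) = (if j < n then coord k j (\<eta> j (Abs_fg (f j))) else 0)" if "n \<le> m" "j < m" for f n j
    using that
    by (induction n) (auto simp: s_def additive_homD[OF additive_hom_coord] \<eta>(2) less_Suc_eq)
  have \<Psi>_eq: "\<Psi> f = code g \<longleftrightarrow> (\<forall>j<m. coord k j (\<eta> j (Abs_fg (f j))) = coord k j g)" for f g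
    by (simp add: \<Psi>_def code_eq_iff s)
  have P: "carrier ?P = (\<Pi>\<^sub>E i\<in>{..<m}. reduced_words {..<2})" by (simp add: carrier_product_group)
  have hom: "\<Psi> \<in> hom ?P B"
  proof (rule homI)
    fix f g assume fg: "f \<in> carrier ?P" "g \<in> carrier ?P"
    have "Abs_fg ((f \<otimes>\<^bsub>?P\<^esub> g) j) = Abs_fg (f j) + Abs_fg (g j)" if "j < m" for j
    proof -
      have "f j \<in> reduced_words {..<2}" "g j \<in> reduced_words {..<2}" using fg that by (auto simp: P)
      then have "reduced (f j)" "reduced (g j)" by (auto simp: reduced_words_def)
      then show ?thesis using that by (simp add: mult_product_group plus_fg_def)
    qed
    then show "\<Psi> (f \<otimes>\<^bsub>?P\<^esub> g) = \<Psi> f \<otimes>\<^bsub>B\<^esub> \<Psi> g"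
      unfolding \<Psi>_def[of f] \<Psi>_def[of g] mult_B \<Psi>_eq
      by (simp add: s additive_homD(1)[OF additive_hom_coord] additive_homD(1)[OF \<eta>(1)])
  qed (simp add: \<Psi>_def)
  have gP: "group ?P" by (rule product_group) (simp add: group_free_group)
  interpret \<Psi>: group_hom ?P B \<Psi>
    using hom gP group_B by (simp add: group_hom_def group_hom_axioms_def)
  have "f = \<one>\<^bsub>?P\<^esub>" if f: "f \<in> carrier ?P" "\<Psi> f = \<one>\<^bsub>B\<^esub>" for f
  proof -
    have "f j = []" if j: "j < m" for j
    proof -
      have w: "f j \<in> reduced_words {..<2}" using f(1) j by (auto simp: P)
      obtain x where x: "f j = word x" "x \<in> letters_in {..<2}" by (rule reduced_wordsE[OF w])
      have "coord k j (\<eta> j (Abs_fg (f j))) = 0"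
        using f(2) j by (simp add: \<Psi>_eq additive_homD(2)[OF additive_hom_coord])
      then have "coord k j (\<eta> j x) = 0" by (simp add: x(1) word_inverse)
      then show ?thesis using \<eta>(3)[OF j x(2)] x(1) by simp
    qed
    then show ?thesis using f(1) by (auto simp: P one_product_group PiE_iff extensional_def)
  qed
  then have inj: "inj_on \<Psi> (carrier ?P)" unfolding \<Psi>.inj_on_one_iff by blast
  let ?H = "\<Psi> ` carrier ?P"
  have "subgroup ?H B" by (rule \<Psi>.img_is_subgroup)
  moreover have "\<Psi> \<in> iso ?P (B\<lparr>carrier := ?H\<rparr>)"
    using hom inj by (auto simp: iso_def hom_def bij_betw_def)
  then have "B\<lparr>carrier := ?H\<rparr> \<cong> ?P" using group.iso_sym[OF gP] by (auto simp: is_iso_def)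
  ultimately show ?thesis unfolding contains_F2_power_def by blast
qed

text \<open>Each factor \<open>F2\<close> is nonabelian in some coordinate; by commutative transitivity two commuting
  nonabelian subgroups cannot share a coordinate.\<close>

lemma product_rank_le:
  assumes "contains_F2_power B n" shows "n \<le> m"
proof -
  let ?F = "free_group {..<2::nat}"
  let ?P = "product_group {..<n} (\<lambda>_. ?F)"
  obtain H where H: "subgroup H B" "B\<lparr>carrier := H\<rparr> \<cong> ?P"
    using assms unfolding contains_F2_power_def by blast
  have "group (B\<lparr>carrier := H\<rparr>)" by (rule subgroup.subgroup_is_group[OF H(1) group_B])
  then have "?P \<cong> B\<lparr>carrier := H\<rparr>" using group.iso_sym H(2) by blast
  then obtain \<theta> where \<theta>: "\<theta> \<in> iso ?P (B\<lparr>carrier := H\<rparr>)" by (auto simp: is_iso_def)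
  have HB: "H \<subseteq> range code" using subgroup.subset[OF H(1)] by simp
  define u where "u i c = (\<lambda>j\<in>{..<n}. if j = i then [(True, c)] else [])" for i and c :: nat
  have "[] \<in> reduced_words {..<2::nat}" "c < 2 \<Longrightarrow> [(True, c)] \<in> reduced_words {..<2}" for c :: nat
    by (auto simp: reduced_words_def)
  then have uP: "u i c \<in> carrier ?P" if "c < 2" for i c
    using that by (simp add: u_def carrier_product_group)
  have \<theta>_mult: "\<theta> (a \<otimes>\<^bsub>?P\<^esub> b) = \<theta> a \<otimes>\<^bsub>B\<^esub> \<theta> b" if "a \<in> carrier ?P" "b \<in> carrier ?P" for a b
    using \<theta> that by (simp add: iso_def hom_def)
  have \<theta>_inj: "inj_on \<theta> (carrier ?P)" using \<theta> by (simp add: iso_def bij_betw_def)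
  have "\<theta> a \<in> range code" if "a \<in> carrier ?P" for a
    using \<theta> that HB by (auto simp: iso_def hom_def)
  then have "\<forall>i c. c < 2 \<longrightarrow> (\<exists>x. \<theta> (u i c) = code x)" using uP by blast
  then obtain x where x: "\<And>i c. c < 2 \<Longrightarrow> \<theta> (u i c) = code (x i c)" by metis
  have comm_iff: "u i c \<otimes>\<^bsub>?P\<^esub> u j d = u j d \<otimes>\<^bsub>?P\<^esub> u i c \<longleftrightarrow>
      (\<forall>l<m. coord k l (x i c) + coord k l (x j d) = coord k l (x j d) + coord k l (x i c))"
    if "c < 2" "d < 2" for i j c d
  proof -
    interpret P: group ?P by (rule product_group) (simp add: group_free_group)
    have "u i c \<otimes>\<^bsub>?P\<^esub> u j d = u j d \<otimes>\<^bsub>?P\<^esub> u i c \<longleftrightarrow>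
        \<theta> (u i c \<otimes>\<^bsub>?P\<^esub> u j d) = \<theta> (u j d \<otimes>\<^bsub>?P\<^esub> u i c)"
      using inj_on_eq_iff[OF \<theta>_inj] P.m_closed uP that by metis
    then show ?thesis
      by (simp only: \<theta>_mult uP that x mult_B code_eq_iff additive_homD(1)[OF additive_hom_coord])
  qed
  have two: "(0::nat) < 2" "(1::nat) < 2" by simp_all
  have "\<exists>l<m. coord k l (x i 0) + coord k l (x i 1) \<noteq> coord k l (x i 1) + coord k l (x i 0)" if "i < n" for i
  proof -
    have "(u i 0 \<otimes>\<^bsub>?P\<^esub> u i 1) i \<noteq> (u i 1 \<otimes>\<^bsub>?P\<^esub> u i 0) i"
      using that by (simp add: mult_product_group u_def)
    then have "u i 0 \<otimes>\<^bsub>?P\<^esub> u i 1 \<noteq> u i 1 \<otimes>\<^bsub>?P\<^esub> u i 0" by metis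
    then show ?thesis unfolding comm_iff[OF two] by blast
  qed
  \<comment> \<open>A coordinate in which the two generators of factor \<open>i\<close> fail to
    commute; injectivity of this choice bounds the number of factors by \<open>m\<close>.\<close>
  then obtain p where p: "\<And>i. i < n \<Longrightarrow> p i < m" "\<And>i. i < n \<Longrightarrow>
      coord k (p i) (x i 0) + coord k (p i) (x i 1) \<noteq> coord k (p i) (x i 1) + coord k (p i) (x i 0)"
    by metis
  have "inj_on p {..<n}"
  proof (rule inj_onI, rule ccontr)
    fix i j assume ij: "i \<in> {..<n}" "j \<in> {..<n}" "p i = p j" "i \<noteq> j"
    have "u j 0 \<otimes>\<^bsub>?P\<^esub> u i c = u i c \<otimes>\<^bsub>?P\<^esub> u j 0" for c
      using ij(4) by (auto simp: mult_product_group u_def)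
    then have c: "coord k (p i) (x j 0) + coord k (p i) (x i c) = coord k (p i) (x i c) + coord k (p i) (x j 0)"
      if "c < 2" for c
      using comm_iff[of 0 c j i] that p(1) ij(1) by simp
    \<comment> \<open>This nontrivial coordinate of an element of factor \<open>j\<close> commutes
      with those of both generators of factor \<open>i\<close>, which would then commute.\<close>
    have "coord k (p i) (x j 0) \<noteq> 0" using p(2)[of j] ij by auto
    then have "coord k (p i) (x i 0) + coord k (p i) (x i 1) = coord k (p i) (x i 1) + coord k (p i) (x i 0)"
      by (rule fg_commute_trans) (use c in auto)
    then show False using p(2)[of i] ij(1) by simp
  qed
  then have "card {..<n} \<le> card {..<m}" by (rule card_inj_on_le) (use p(1) in auto)
  then show ?thesis by simp
qed

lemma has_product_rank_B: "has_product_rank B m"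
  using contains_F2_power_B product_rank_le by (simp add: has_product_rank_def)

end

section \<open>Choice of the number of digits and asymptotics\<close>

theorem corollary1p4:
  shows "\<exists>B :: nat \<Rightarrow> nat monoid.
    (\<forall>m \<ge> 1. group (B m) \<and> finitely_presented (B m) \<and> centerless (B m) \<and>
       residually_free (B m) \<and> has_product_rank (B m) m) \<and>
    (\<lambda>m. real (min_generators (B m))) \<in> O(\<lambda>m. ln (real m))"
proof -
  \<comment> \<open>Enough binary digits for \<open>m\<close> coordinates; the successor keeps
    \<open>k\<close> positive even for \<open>m = 1\<close>.\<close>
  define k where "k m = Suc (nat \<lceil>log 2 (real m)\<rceil>)" for m
  have bf: "binary_family (k m) m" if "m \<ge> 1" for m
  proof
    have "real m = 2 powr log 2 (real m)" using that by simp
    also have "\<dots> \<le> 2 powr real (k m)" by (rule powr_mono) (simp_all add: k_def, linarith)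
    finally have "real m \<le> real (2 ^ k m)" by (simp add: powr_realpow)
    then show "m \<le> 2 ^ k m" by (simp only: of_nat_le_iff)
  qed (simp add: k_def)
  let ?B = "\<lambda>m. binary_family.B (k m) m"
  have "(\<lambda>m. real (min_generators (?B m))) \<in> O(\<lambda>m. ln (real m))"
  \<comment> \<open>From \<open>m = 2\<close> on, \<open>log 2 m\<close> is at least
    \<open>1\<close>, so \<open>4 * (log 2 m + 2)\<close> is at most \<open>12 * log 2 m\<close>;
    the division by \<open>ln 2\<close> changes the base.\<close>
  proof (rule bigoI[of _ "12 / ln 2"], rule eventually_mono[OF eventually_ge_at_top[of 2]])
    fix m :: nat assume m: "m \<ge> 2"
    have l: "log 2 (real m) \<ge> 1" using m by (simp add: le_log_iff)
    have "real (min_generators (?B m)) \<le> real (4 * k m)"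
      using binary_family.min_generators_B[OF bf[of m]] m by linarith
    also have "\<dots> \<le> 4 * (log 2 (real m) + 2)" using l by (simp add: k_def) linarith
    also have "\<dots> \<le> 12 * log 2 (real m)" using l by simp
    also have "\<dots> = 12 / ln 2 * ln (real m)" by (simp add: log_def)
    finally show "norm (real (min_generators (?B m))) \<le> 12 / ln 2 * norm (ln (real m))"
      using m by simp
  qed
  moreover have "group (?B m) \<and> finitely_presented (?B m) \<and> centerless (?B m) \<and>
      residually_free (?B m) \<and> has_product_rank (?B m) m" if "m \<ge> 1" for m
  proof -
    interpret binary_family "k m" m by (rule bf[OF that])
    show ?thesis
      using group_B finitely_presented_B centerless_B residually_free_B has_product_rank_B by blast
  qed
  ultimately show ?thesis by (intro exI[of _ ?B]) auto
qed

end
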